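(* The numerical method $\Xi^{[3]}$ is convergent, its global error $\|\psi(T)-\psi_T\|$ does not grow with $\tilde\omega=\max_{n=1,\dots,N}|\omega_n|$, and it exhibits third (global) order of accuracy in time, meaning that $\|\psi(T)-\psi_T\|\le C h^3$ as $h\to0$. Here $\psi_T$ denotes the numerical approximation of $\psi(T)$ produced by $\Xi^{[3]}$ with time step $h$.
   Context: Problem: $\psi$ solves the Klein--Gordon equation $\partial_t^2\psi(x,t)=\Delta\psi(x,t)+m(x,t)\psi(x,t)$, $t\in[t_0,T]$, $x\in\mathbb T^d$ (periodic boundary conditions), with prescribed initial data $\psi(\cdot,t_0)$ and $\partial_t\psi(\cdot,t_0)$. Dependence on $x$ is suppressed: $\psi(t),a_n(t),m(t)$ stand for $\psi(\cdot,t),a_n(\cdot,t),m(\cdot,t)$, and primes denote time derivatives. Here $m(x,t)=\sum_{n=1}^N a_n(x,t)e^{i\omega_n t}$ with $m(x,t)<0$ and frequencies $\omega_n\in\mathbb R$; the coefficients $a_n$ do not oscillate in the $\omega_n$, i.e. their time derivatives are bounded independently of the $\omega_n$. It is assumed that $\psi'''\in L_1([t_0,T])$. The operator $-\Delta$ is taken to be positive definite, and $G$ is a positive definite operator with $G\cdot G=-\Delta$. The result concerns time integration, to be combined with a space discretisation: in applications functions are replaced by vectors and $G$ by a positive, finite-dimensional operator, so that $\|G\|$ is understood to be bounded. Grid: $K$ is the number of time steps, $h=(T-t_0)/K$, $t_k=t_0+kh$, so that $T=t_K$ and $\psi_T=\psi_K$. Numerical scheme $\Xi^{[3]}$: $\psi_k$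 and $\psi_k'$ denote the numerical approximations of $\psi(t_k)$ and $\psi'(t_k)$, defined by $\psi_0=\psi(t_0)$, $\psi_0'=\psi'(t_0)$, $\psi_0''=\Delta\psi(t_0)+m(t_0)\psi(t_0)$ and, for $k=0,\dots,K-1$, $$\psi_{k+1}=\cos(hG)\psi_k+G^{-1}\sin(hG)\psi_k'+\int_0^hG^{-1}\sin((h-\tau)G)\,m(t_k+\tau)\,P_k(\tau)\,d\tau,$$ $$\psi_{k+1}'=-G\sin(hG)\psi_k+\cos(hG)\psi_k'+\int_0^h\cos((h-\tau)G)\,m(t_k+\tau)\,P_k(\tau)\,d\tau,$$ where $P_0(\tau)=\psi_0+\tau\psi_0'+\frac{\tau^2}{2}\psi_0''$ and $P_k(\tau)=\psi_k+\tau\psi_k'+\frac{\tau^2}{2h}(\psi_k'-\psi_{k-1}')$ for $k\ge1$. *)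

theory Defs
  imports "HOL-Analysis.Analysis"
begin

text \<open>
  The equation is taken after a space discretisation: a function of \<open>x\<close> is the vector of its
  values at finitely many grid points, indexed by an arbitrary finite type \<open>'x\<close>, so it is an
  element of \<open>complex^'x\<close>.  In that type \<open>*\<close> is the componentwise product; it is the
  multiplication of functions of \<open>x\<close>, e.g. in \<open>m t * \<psi> t\<close>.  Matrices act by \<open>*v\<close>.
\<close>

definition pos_definite :: "complex^'x^'x \<Rightarrow> bool" where
  "pos_definite A \<longleftrightarrow>
     (\<forall>i j. A $ i $ j = cnj (A $ j $ i)) \<and>
     (\<forall>v. v \<noteq> 0 \<longrightarrow> 0 < Re (\<Sum>i\<in>UNIV. cnj (v $ i) * (A *v v) $ i))"

text \<open>Powers with respect to \<open>**\<close>; the overloaded \<open>^\<close> would be taken entrywise.\<close>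

definition mat_power :: "complex^'x^'x \<Rightarrow> nat \<Rightarrow> complex^'x^'x" where
  "mat_power A k = (((**) A) ^^ k) (mat 1)"

definition mat_cos :: "complex^'x^'x \<Rightarrow> complex^'x^'x" where
  "mat_cos A = (\<Sum>k. ((-1) ^ k / fact (2 * k)) *\<^sub>R mat_power A (2 * k))"

definition mat_sin :: "complex^'x^'x \<Rightarrow> complex^'x^'x" where
  "mat_sin A = (\<Sum>k. ((-1) ^ k / fact (2 * k + 1)) *\<^sub>R mat_power A (2 * k + 1))"

definition mass :: "nat \<Rightarrow> (nat \<Rightarrow> real) \<Rightarrow> (nat \<Rightarrow> real \<Rightarrow> complex^'x) \<Rightarrow> real \<Rightarrow> complex^'x" where
  "mass N \<omega> a t = (\<chi> x. \<Sum>n=1..N. a n t $ x * exp (\<i> * of_real (\<omega> n * t)))"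

definition negative_mass :: "real \<Rightarrow> real \<Rightarrow> (real \<Rightarrow> complex^'x) \<Rightarrow> bool" where
  "negative_mass t0 T m \<longleftrightarrow> (\<forall>t\<in>{t0..T}. \<forall>x. m t $ x \<in> \<real> \<and> Re (m t $ x) < 0)"

text \<open>
  The coefficients do not oscillate: they and their time derivatives are bounded by \<open>A\<close>.  The
  coefficients may vary with the frequencies, but \<open>A\<close> may not.
\<close>

definition nonoscillatory_coeffs ::
  "real \<Rightarrow> real \<Rightarrow> nat \<Rightarrow> real \<Rightarrow> (nat \<Rightarrow> real \<Rightarrow> complex^'x) \<Rightarrow> bool" where
  "nonoscillatory_coeffs t0 T N A a \<longleftrightarrow>
     (\<forall>n\<in>{1..N}. \<exists>a'. \<forall>t\<in>{t0..T}.
        (a n has_vector_derivative a' t) (at t within {t0..T}) \<and>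
        (\<forall>x. norm (a n t $ x) \<le> A \<and> norm (a' t $ x) \<le> A))"

text \<open>
  \<open>L\<close> is the discrete Laplacian, \<open>u\<close> and \<open>v\<close> are the initial data, and \<open>\<psi>1\<close>, \<open>\<psi>2\<close>, \<open>\<psi>3\<close> are the
  first three time derivatives of \<open>\<psi>\<close>.
\<close>

definition KG_solution ::
  "complex^'x^'x \<Rightarrow> (real \<Rightarrow> complex^'x) \<Rightarrow> real \<Rightarrow> real \<Rightarrow> complex^'x \<Rightarrow> complex^'x \<Rightarrow>
   (real \<Rightarrow> complex^'x) \<Rightarrow> (real \<Rightarrow> complex^'x) \<Rightarrow> (real \<Rightarrow> complex^'x) \<Rightarrow> (real \<Rightarrow> complex^'x) \<Rightarrow> bool"
where
  "KG_solution L m t0 T u v \<psi> \<psi>1 \<psi>2 \<psi>3 \<longleftrightarrow>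
     \<psi> t0 = u \<and> \<psi>1 t0 = v \<and>
     (\<forall>t\<in>{t0..T}.
        (\<psi> has_vector_derivative \<psi>1 t) (at t within {t0..T}) \<and>
        (\<psi>1 has_vector_derivative \<psi>2 t) (at t within {t0..T}) \<and>
        (\<psi>2 has_vector_derivative \<psi>3 t) (at t within {t0..T}) \<and>
        \<psi>2 t = L *v \<psi> t + m t * \<psi> t) \<and>
     \<psi>3 absolutely_integrable_on {t0..T}"

text \<open>
  One step of length \<open>h\<close> from time \<open>s\<close>: the variation-of-constants formula with the unknown
  solution replaced by \<open>P\<close> under the integrals.
\<close>

definition Xi3_step ::
  "complex^'x^'x \<Rightarrow> (real \<Rightarrow> complex^'x) \<Rightarrow> real \<Rightarrow> real \<Rightarrow> (real \<Rightarrow> complex^'x) \<Rightarrow>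
   (complex^'x) \<times> (complex^'x) \<Rightarrow> (complex^'x) \<times> (complex^'x)" where
  "Xi3_step G m h s P = (\<lambda>(p, q).
     (mat_cos (h *\<^sub>R G) *v p + (matrix_inv G ** mat_sin (h *\<^sub>R G)) *v q
        + integral {0..h} (\<lambda>\<tau>. (matrix_inv G ** mat_sin ((h - \<tau>) *\<^sub>R G)) *v (m (s + \<tau>) * P \<tau>)),
      - ((G ** mat_sin (h *\<^sub>R G)) *v p) + mat_cos (h *\<^sub>R G) *v q
        + integral {0..h} (\<lambda>\<tau>. mat_cos ((h - \<tau>) *\<^sub>R G) *v (m (s + \<tau>) * P \<tau>))))"

text \<open>
  \<open>Xi3 L G m t0 h u v k\<close> is the pair of the approximations of \<open>\<psi>\<close> and of its time derivative at
  time \<open>t0 + k * h\<close>.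
\<close>

fun Xi3 ::
  "complex^'x^'x \<Rightarrow> complex^'x^'x \<Rightarrow> (real \<Rightarrow> complex^'x) \<Rightarrow> real \<Rightarrow> real \<Rightarrow>
   complex^'x \<Rightarrow> complex^'x \<Rightarrow> nat \<Rightarrow> (complex^'x) \<times> (complex^'x)" where
  "Xi3 L G m t0 h u v 0 = (u, v)"
| "Xi3 L G m t0 h u v (Suc 0) =
     Xi3_step G m h t0
       (\<lambda>\<tau>. u + \<tau> *\<^sub>R v + (\<tau>\<^sup>2 / 2) *\<^sub>R (L *v u + m t0 * u)) (u, v)"
| "Xi3 L G m t0 h u v (Suc (Suc k)) =
     (let (p, q) = Xi3 L G m t0 h u v (Suc k);
          q' = snd (Xi3 L G m t0 h u v k)
      in Xi3_step G m h (t0 + real (Suc k) * h)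
           (\<lambda>\<tau>. p + \<tau> *\<^sub>R q + (\<tau>\<^sup>2 / (2 * h)) *\<^sub>R (q - q')) (p, q))"

definition step_size :: "real \<Rightarrow> real \<Rightarrow> nat \<Rightarrow> real" where
  "step_size t0 T K = (T - t0) / real K"

text \<open>Norm of the error at time \<open>T\<close> after \<open>K\<close> steps.\<close>

definition Xi3_global_error ::
  "complex^'x^'x \<Rightarrow> complex^'x^'x \<Rightarrow> (real \<Rightarrow> complex^'x) \<Rightarrow> real \<Rightarrow> real \<Rightarrow>
   complex^'x \<Rightarrow> complex^'x \<Rightarrow> (real \<Rightarrow> complex^'x) \<Rightarrow> nat \<Rightarrow> real" where
  "Xi3_global_error L G m t0 T u v \<psi> K =
     norm (\<psi> T - fst (Xi3 L G m t0 (step_size t0 T K) u v K))"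

end

theory Submission
  imports Defs
begin

text \<open>
  The exact solution satisfies the variation-of-constants formula, which says that it performs
  steps of the method with the solution itself in place of the quadratic \<open>P\<close> (\<open>step_exact\<close>).  A
  step is affine in the data and in \<open>P\<close> and differs from the identity by \<open>O(h)\<close>, with a constant
  that depends on \<open>G\<close>, on \<open>T - t0\<close> and on a bound for \<open>m\<close>.  The error, exact minus numerical,
  therefore obeys a two-step recursion that amplifies by a bounded factor over the whole interval
  (\<open>two_step_Gronwall\<close>) and is driven by the integrals of \<open>m\<close> times the defect, which is the
  solution minus the quadratic built from exact values.

  The backward difference of \<open>\<psi>'\<close> in the quadratic is an average of \<open>\<psi>''\<close> over the preceding grid
  interval (the first step uses \<open>\<psi>''(t0)\<close> itself), so the defect on step \<open>k\<close> is at most \<open>h\<^sup>2\<close> times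
  the oscillation of \<open>\<psi>''\<close> over two grid intervals, and the local error at most a constant multiple
  of \<open>h\<^sup>3\<close> times it.  The energy estimate bounds \<open>\<psi>\<close>, \<open>\<psi>'\<close>, \<open>\<psi>''\<close> independently of the frequencies,
  which gives the frequency-independent bound \<open>O(h\<^sup>2)\<close> and hence convergence.  Bounding the
  oscillations by integrals of \<open>|\<psi>'''|\<close> instead, and summing, gives \<open>C h\<^sup>3\<close> times the \<open>L\<^sub>1\<close> norm
  of \<open>\<psi>'''\<close>.

  That norm may grow with the frequencies, since \<open>\<psi>'''\<close> contains \<open>m' \<psi>\<close>.  The third-order bound with
  a frequency-independent constant rests on a cancellation.  To leading order the local error in
  the velocity is \<open>(h\<^sup>3/8) m \<delta>\<close>, where \<open>\<delta>\<close> is the increment of \<open>\<psi>''\<close> over the step.  Up to \<open>O(h)\<close>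
  the increment of \<open>\<psi>'' = L \<psi> + m \<psi>\<close> is that of \<open>m\<close> times \<open>\<psi>\<close>; and \<open>m\<close> times the increment of \<open>m\<close>
  is half the increment of \<open>m\<^sup>2\<close>, up to the square of the increment of \<open>m\<close>.  Thus \<open>(h\<^sup>3/8) m \<delta>\<close> is
  up to smaller terms, the increment of \<open>b = (h\<^sup>3/16) m\<^sup>2 \<psi>\<close>, which is bounded by \<open>C h\<^sup>3\<close> independently of the
  frequencies.

  Subtracting \<open>b\<close> from the error leaves three kinds of perturbations: that of the first step, which
  is \<open>O(h\<^sup>3)\<close>; those of size \<open>O(h\<^sup>4)\<close>, whose sum is \<open>O(h\<^sup>3)\<close>, both uniformly in the frequencies; and
  those whose sum is \<open>o(h\<^sup>3)\<close> for each fixed solution, at a rate that may depend on the frequencies,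
  so that it falls below a fixed multiple of \<open>h\<^sup>3\<close> once \<open>h\<close> is small enough.  The last kind is
  controlled by the uniform continuity of \<open>m\<close> and by approximating \<open>\<psi>'''\<close> in \<open>L\<^sub>1\<close> by a continuous
  function, which is nearly constant on short intervals.
\<close>

section \<open>Approximation in the mean by continuous functions\<close>

text \<open>
  A measurable function is an almost everywhere limit of continuous functions, but those need not
  be dominated.  Projecting values onto a ball fixes this: the projection of \<open>f\<close> onto a large ball
  is close to \<open>f\<close> in \<open>L\<^sub>1\<close>, and the continuous functions, projected onto the same ball, converge
  boundedly.  Dominated convergence applies to each of the two approximations.
\<close>

lemma absolutely_integrable_approx_continuous:
  fixes f :: "real \<Rightarrow> 'a::euclidean_space"
  assumes f: "f absolutely_integrable_on {a..b}" and "0 < \<epsilon>"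
  obtains g where "continuous_on {a..b} g" "integral {a..b} (\<lambda>x. norm (f x - g x)) < \<epsilon>"
proof -
  let ?S = "{a..b}"
  define c :: "nat \<Rightarrow> 'a \<Rightarrow> 'a" where "c n = closest_point (cball 0 (real n))" for n
  have c_norm: "norm (c n v) \<le> real n" for n v
    using closest_point_in_set[of "cball 0 (real n)" v] by (simp add: c_def)
  have c_self: "c n v = v" if "norm v \<le> real n" for n v
    using closest_point_self[of v "cball 0 (real n)"] that by (simp add: c_def)
  have c_dist: "norm (v - c n v) \<le> norm v" for n v
    using closest_point_le[of "cball 0 (real n)" 0 v] by (simp add: c_def dist_norm)
  have c_cont: "continuous_on UNIV (c n)" for n
    unfolding c_def by (intro continuous_on_closest_point) auto
  have S: "?S \<in> sets lebesgue" by simp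
  have fm: "f \<in> borel_measurable (lebesgue_on ?S)"
    using f absolutely_integrable_measurable[OF S] by blast
  have cm: "(\<lambda>x. c n (f x)) \<in> borel_measurable (lebesgue_on ?S)" for n
    using borel_measurable_continuous_onI[OF c_cont] fm by (rule measurable_compose_rev)
  have nf: "(\<lambda>x. norm (f x)) integrable_on ?S"
    using f by (simp add: absolutely_integrable_on_def)
  have i1: "(\<lambda>x. norm (f x - c n (f x))) integrable_on ?S" for n
    by (rule measurable_bounded_by_integrable_imp_integrable[OF _ nf])
       (use fm cm c_dist in auto)
  have "(\<lambda>n. integral ?S (\<lambda>x. norm (f x - c n (f x)))) \<longlonglongrightarrow> integral ?S (\<lambda>x. 0::real)"
  proof (rule dominated_convergence[OF i1 nf])
    fix x
    have "\<forall>\<^sub>F n in sequentially. norm (f x - c n (f x)) = 0"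
      using eventually_ge_at_top[of "nat \<lceil>norm (f x)\<rceil>"]
      by eventually_elim (simp add: c_self nat_ceiling_le_eq)
    then show "(\<lambda>n. norm (f x - c n (f x))) \<longlonglongrightarrow> 0"
      by (rule tendsto_eventually)
  qed (use c_dist in auto)
  then have "\<forall>\<^sub>F n in sequentially. integral ?S (\<lambda>x. norm (f x - c n (f x))) < \<epsilon> / 2"
    using \<open>0 < \<epsilon>\<close> by (intro order_tendstoD) auto
  then obtain n where n: "integral ?S (\<lambda>x. norm (f x - c n (f x))) < \<epsilon> / 2"
    by (auto simp: eventually_sequentially)
  have "f measurable_on ?S"
    using fm S by (simp add: measurable_on_iff_borel_measurable)
  then obtain Z G where Z: "negligible Z" and G: "\<And>k. continuous_on UNIV (G k)"
    and lim: "\<And>x. x \<notin> Z \<Longrightarrow> (\<lambda>k. G k x) \<longlonglongrightarrow> (if x \<in> ?S then f x else 0)"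
    unfolding measurable_on_def by blast
  have cG: "continuous_on T (\<lambda>x. c n (G k x))" for k T
    using continuous_on_compose2[OF c_cont G] continuous_on_subset by blast
  have cGm: "(\<lambda>x. c n (G k x)) \<in> borel_measurable (lebesgue_on ?S)" for k
    by (intro continuous_imp_measurable_on_sets_lebesgue cG S)
  have b2: "norm (c n v - c n w) \<le> 2 * real n" for v w
    using norm_triangle_ineq4[of "c n v" "c n w"] c_norm[of n v] c_norm[of n w] by linarith
  have i2: "(\<lambda>x. norm (c n (f x) - c n (G k x))) integrable_on ?S" for k
    by (rule measurable_bounded_by_integrable_imp_integrable[of _ _ "\<lambda>x. 2 * real n"])
       (use cm cGm b2 in auto)
  let ?d = "\<lambda>k x. if x \<in> Z then 0 else norm (c n (f x) - c n (G k x))"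
  have i3: "?d k integrable_on ?S" for k
    using integrable_spike[OF i2 Z, where g="?d k"] by simp
  have "(\<lambda>k. integral ?S (?d k)) \<longlonglongrightarrow> integral ?S (\<lambda>x. 0::real)"
  proof (rule dominated_convergence[OF i3])
    show "(\<lambda>x. 2 * real n) integrable_on ?S" by (intro integrable_const_ivl)
    show "norm (?d k x) \<le> 2 * real n" for k x using b2 by auto
    show "(\<lambda>k. ?d k x) \<longlonglongrightarrow> 0" if "x \<in> ?S" for x
    proof (cases "x \<in> Z")
      case False
      have "(\<lambda>k. c n (G k x)) \<longlonglongrightarrow> c n (f x)"
        using lim[OF False] that c_cont[of n]
        by (auto intro: continuous_on_tendsto_compose)
      then show ?thesis using False tendsto_norm[OF tendsto_diff[OF tendsto_const[of "c n (f x)"]]]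
        by fastforce
    qed auto
  qed
  then have "\<forall>\<^sub>F k in sequentially. integral ?S (?d k) < \<epsilon> / 2"
    using \<open>0 < \<epsilon>\<close> by (intro order_tendstoD) auto
  then obtain k where "integral ?S (?d k) < \<epsilon> / 2"
    by (auto simp: eventually_sequentially)
  moreover have "integral ?S (?d k) = integral ?S (\<lambda>x. norm (c n (f x) - c n (G k x)))"
    by (rule integral_spike[OF Z]) auto
  ultimately have k: "integral ?S (\<lambda>x. norm (c n (f x) - c n (G k x))) < \<epsilon> / 2" by simp
  have tri: "norm (f x - c n (G k x)) \<le> norm (f x - c n (f x)) + norm (c n (f x) - c n (G k x))" for x
    using norm_triangle_ineq[of "f x - c n (f x)" "c n (f x) - c n (G k x)"] by simp
  have "integral ?S (\<lambda>x. norm (f x - c n (G k x)))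
      \<le> integral ?S (\<lambda>x. norm (f x - c n (f x)) + norm (c n (f x) - c n (G k x)))"
  proof (rule integral_le)
    show "(\<lambda>x. norm (f x - c n (G k x))) integrable_on ?S"
      by (rule measurable_bounded_by_integrable_imp_integrable[OF _ integrable_add[OF i1[of n] i2[of k]]])
         (use fm cGm tri in auto)
  qed (auto intro!: integrable_add i1 i2 tri)
  also have "\<dots> = integral ?S (\<lambda>x. norm (f x - c n (f x))) + integral ?S (\<lambda>x. norm (c n (f x) - c n (G k x)))"
    by (intro integral_add i1 i2)
  finally have "integral ?S (\<lambda>x. norm (f x - c n (G k x))) < \<epsilon>" using n k by linarith
  with cG show thesis using that by blast
qed

section \<open>Mean values, increments and remainders\<close>

lemma vector_derivative_norm_bound:
  fixes f :: "real \<Rightarrow> 'a::real_normed_vector"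
  assumes f: "\<And>t. t \<in> {a..b} \<Longrightarrow> (f has_vector_derivative f' t) (at t within {a..b})"
    and B: "\<And>t. t \<in> {a..b} \<Longrightarrow> norm (f' t) \<le> B"
    and "x \<in> {a..b}" "y \<in> {a..b}"
  shows "norm (f x - f y) \<le> B * \<bar>x - y\<bar>"
proof -
  have "norm (f x - f y) \<le> B * norm (x - y)"
  proof (rule differentiable_bound[where S="{a..b}" and f'="\<lambda>t h. h *\<^sub>R f' t"])
    show "(f has_derivative (\<lambda>h. h *\<^sub>R f' t)) (at t within {a..b})" if "t \<in> {a..b}" for t
      using f[OF that] by (simp add: has_vector_derivative_def)
    show "onorm (\<lambda>h. h *\<^sub>R f' t) \<le> B" if "t \<in> {a..b}" for t
    proof (rule onorm_le)
      show "norm (h *\<^sub>R f' t) \<le> B * norm h" for h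
        using mult_left_mono[OF B[OF that], of "\<bar>h\<bar>"] by (simp add: mult.commute)
    qed
  qed (use assms in auto)
  then show ?thesis by simp
qed

lemma has_vector_derivative_shift:
  fixes f :: "real \<Rightarrow> 'a::real_normed_vector"
  assumes "(f has_vector_derivative D) (at (s + \<tau>) within A)" "\<And>t. t \<in> S \<Longrightarrow> s + t \<in> A"
  shows "((\<lambda>\<tau>. f (s + \<tau>)) has_vector_derivative D) (at \<tau> within S)"
proof -
  have "(f has_vector_derivative D) (at (s + \<tau>) within (\<lambda>\<tau>. s + \<tau>) ` S)"
    by (rule has_vector_derivative_within_subset[OF assms(1)]) (use assms in auto)
  moreover have "((\<lambda>\<tau>. s + \<tau>) has_vector_derivative 1) (at \<tau> within S)"
    by (auto intro!: derivative_eq_intros simp flip: has_real_derivative_iff_has_vector_derivative)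
  ultimately show ?thesis
    using vector_diff_chain_within[of "\<lambda>\<tau>. s + \<tau>" 1 \<tau> S f D] by (simp add: o_def)
qed

text \<open>
  With \<open>\<gamma> = 0\<close> this bounds an oscillation by the variation; with \<open>\<gamma>\<close> close to \<open>f\<close> in the mean it says
  that \<open>F\<close> is nearly affine.
\<close>

lemma increment_minus_linear_le:
  fixes F :: "real \<Rightarrow> 'a::euclidean_space"
  assumes F: "\<And>t. t \<in> {a..b} \<Longrightarrow> (F has_vector_derivative f t) (at t within {a..b})"
    and int: "(\<lambda>t. norm (f t - \<gamma>)) integrable_on {a..b}"
    and xy: "x \<in> {a..b}" "y \<in> {a..b}"
  shows "norm (F x - F y - (x - y) *\<^sub>R \<gamma>) \<le> integral {a..b} (\<lambda>t. norm (f t - \<gamma>))"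
proof -
  have *: "norm (F x - F y - (x - y) *\<^sub>R \<gamma>) \<le> integral {a..b} (\<lambda>t. norm (f t - \<gamma>))"
    if "y \<le> x" "x \<in> {a..b}" "y \<in> {a..b}" for x y
  proof -
    have "(f has_integral F x - F y) {y..x}"
      using that by (intro fundamental_theorem_of_calculus has_vector_derivative_within_subset[OF F]) auto
    from has_integral_diff[OF this has_integral_const_real[of \<gamma> y x]]
    have I: "((\<lambda>t. f t - \<gamma>) has_integral F x - F y - (x - y) *\<^sub>R \<gamma>) {y..x}"
      using that by simp
    have sub: "(\<lambda>t. norm (f t - \<gamma>)) integrable_on {y..x}"
      using that by (intro integrable_subinterval_real[OF int]) auto
    have "norm (F x - F y - (x - y) *\<^sub>R \<gamma>) \<le> integral {y..x} (\<lambda>t. norm (f t - \<gamma>))"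
      unfolding integral_unique[OF I, symmetric]
      by (rule integral_norm_bound_integral[OF has_integral_integrable[OF I] sub]) simp
    also have "\<dots> \<le> integral {a..b} (\<lambda>t. norm (f t - \<gamma>))"
      using that by (intro integral_subset_le sub int) auto
    finally show ?thesis .
  qed
  have flip: "norm (F x - F y - (x - y) *\<^sub>R \<gamma>) = norm (F y - F x - (y - x) *\<^sub>R \<gamma>)"
    by (subst norm_minus_cancel[symmetric]) (simp add: algebra_simps)
  show ?thesis
    using *[of y x] *[of x y] xy flip by (cases "y \<le> x") auto
qed

lemma has_vector_derivative_scaleR_const:
  fixes w :: "'a::real_normed_vector"
  assumes "(p has_real_derivative p') (at t within S)"
  shows "((\<lambda>t. p t *\<^sub>R w) has_vector_derivative p' *\<^sub>R w) (at t within S)"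
  using bounded_linear.has_vector_derivative[OF bounded_linear_scaleR_left] assms
  by (simp add: has_real_derivative_iff_has_vector_derivative)

text \<open>
  The factor \<open>1/2\<close> is given up: two applications of the mean value inequality are enough.
\<close>

lemma second_order_remainder:
  fixes f :: "real \<Rightarrow> 'a::real_normed_vector"
  assumes f: "\<And>t. t \<in> {0..h} \<Longrightarrow> (f has_vector_derivative f1 t) (at t within {0..h})"
    and f1: "\<And>t. t \<in> {0..h} \<Longrightarrow> (f1 has_vector_derivative f2 t) (at t within {0..h})"
    and f2: "\<And>t. t \<in> {0..h} \<Longrightarrow> norm (f2 t) \<le> \<eta>"
    and 0: "f 0 = 0" "f1 0 = 0" and t: "t \<in> {0..h}"
  shows "norm (f t) \<le> \<eta> * t\<^sup>2"
proof -
  have h: "0 \<le> h" using t by auto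
  have \<eta>: "0 \<le> \<eta>" using f2[OF t] norm_ge_zero[of "f2 t"] by linarith
  have b: "norm (f1 s) \<le> \<eta> * t" if "s \<in> {0..t}" for s
  proof -
    have "norm (f1 s - f1 0) \<le> \<eta> * \<bar>s - 0\<bar>"
      using that t by (intro vector_derivative_norm_bound[OF f1 f2]) auto
    also have "\<dots> \<le> \<eta> * t" using \<eta> that by (intro mult_left_mono) auto
    finally show ?thesis using 0 by simp
  qed
  have "norm (f t - f 0) \<le> (\<eta> * t) * \<bar>t - 0\<bar>"
    using t by (intro vector_derivative_norm_bound[of 0 t f f1] b has_vector_derivative_within_subset[OF f]) auto
  then show ?thesis using 0 t by (simp add: power2_eq_square)
qed

lemma Taylor_quadratic_error:
  fixes f f1 f2 :: "real \<Rightarrow> 'a::real_normed_vector"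
  assumes f: "\<And>t. t \<in> {s..s+h} \<Longrightarrow> (f has_vector_derivative f1 t) (at t within {s..s+h})"
    and f1: "\<And>t. t \<in> {s..s+h} \<Longrightarrow> (f1 has_vector_derivative f2 t) (at t within {s..s+h})"
    and f2: "\<And>x. x \<in> {s..s+h} \<Longrightarrow> norm (f2 x - f2 s) \<le> \<eta>"
    and \<tau>: "\<tau> \<in> {0..h}"
  shows "norm (f (s + \<tau>) - (f s + \<tau> *\<^sub>R f1 s + (\<tau>\<^sup>2 / 2) *\<^sub>R f2 s)) \<le> \<eta> * \<tau>\<^sup>2"
proof (rule second_order_remainder[where h=h])
  fix t assume t: "t \<in> {0..h}"
  note sh = has_vector_derivative_shift[where S="{0..h}" and A="{s..s+h}"]
  have st: "s + t \<in> {s..s+h}" using t by auto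
  show "((\<lambda>\<tau>. f (s + \<tau>) - (f s + \<tau> *\<^sub>R f1 s + (\<tau>\<^sup>2 / 2) *\<^sub>R f2 s)) has_vector_derivative
      f1 (s + t) - (f1 s + t *\<^sub>R f2 s)) (at t within {0..h})"
    by (auto intro!: derivative_eq_intros sh f st)
  show "((\<lambda>t. f1 (s + t) - (f1 s + t *\<^sub>R f2 s)) has_vector_derivative f2 (s + t) - f2 s) (at t within {0..h})"
    by (auto intro!: derivative_eq_intros sh f1 st)
  show "norm (f2 (s + t) - f2 s) \<le> \<eta>" using f2[OF st] .
qed (use \<tau> in auto)

text \<open>
  The backward difference of \<open>f1\<close> is the mean of \<open>f2\<close> over \<open>[s - h, s]\<close>.  If \<open>f2\<close> were affine with
  increment \<open>\<delta>\<close> over a length \<open>h\<close>, then \<open>f2 (s + \<tau>)\<close> would exceed this mean by \<open>(\<tau>/h + 1/2) \<delta>\<close>, and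
  integrating twice gives the coefficient of \<open>\<delta>\<close>.  The case \<open>\<delta> = 0\<close> is the crude bound by the
  oscillation of \<open>f2\<close>.
\<close>

lemma extrapolation_error:
  fixes f f1 f2 :: "real \<Rightarrow> 'a::real_normed_vector"
  assumes "0 < h"
    and f: "\<And>t. t \<in> {s-h..s+h} \<Longrightarrow> (f has_vector_derivative f1 t) (at t within {s-h..s+h})"
    and f1: "\<And>t. t \<in> {s-h..s+h} \<Longrightarrow> (f1 has_vector_derivative f2 t) (at t within {s-h..s+h})"
    and f2: "\<And>x y. x \<in> {s-h..s+h} \<Longrightarrow> y \<in> {s-h..s+h} \<Longrightarrow> norm (f2 x - f2 y - ((x - y) / h) *\<^sub>R \<delta>) \<le> \<eta>"
    and \<tau>: "\<tau> \<in> {0..h}"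
  shows "norm (f (s + \<tau>) - (f s + \<tau> *\<^sub>R f1 s + (\<tau>\<^sup>2 / (2 * h)) *\<^sub>R (f1 s - f1 (s - h)))
           - (\<tau>^3 / (6 * h) + \<tau>\<^sup>2 / 4) *\<^sub>R \<delta>) \<le> \<eta> * \<tau>\<^sup>2"
proof (rule second_order_remainder[where h=h])
  fix t assume t: "t \<in> {0..h}"
  have sh: "((\<lambda>\<tau>. g (s + \<tau>)) has_vector_derivative D) (at t within {0..h})"
    if "(g has_vector_derivative D) (at (s + t) within {s-h..s+h})" for g :: "real \<Rightarrow> 'a" and D
    by (rule has_vector_derivative_shift[OF that]) (use \<open>0 < h\<close> in auto)
  have p: "((\<lambda>\<tau>. \<tau>) has_real_derivative 1) (at t within {0..h})"
    "((\<lambda>\<tau>. \<tau>\<^sup>2 / (2 * h)) has_real_derivative t / h) (at t within {0..h})"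
    "((\<lambda>\<tau>. \<tau>^3 / (6 * h) + \<tau>\<^sup>2 / 4) has_real_derivative t\<^sup>2 / (2 * h) + t / 2) (at t within {0..h})"
    "((\<lambda>\<tau>. \<tau> / h) has_real_derivative 1 / h) (at t within {0..h})"
    "((\<lambda>\<tau>. \<tau>\<^sup>2 / (2 * h) + \<tau> / 2) has_real_derivative t / h + 1 / 2) (at t within {0..h})"
    using \<open>0 < h\<close> by (auto intro!: derivative_eq_intros simp: field_simps power2_eq_square)
  note sc = has_vector_derivative_scaleR_const
  note ad = has_vector_derivative_add and di = has_vector_derivative_diff and co = has_vector_derivative_const
  have st: "s + t \<in> {s-h..s+h}" using t by auto
  let ?w = "f1 s - f1 (s - h)"
  show "((\<lambda>\<tau>. f (s + \<tau>) - (f s + \<tau> *\<^sub>R f1 s + (\<tau>\<^sup>2 / (2 * h)) *\<^sub>R ?w) - (\<tau>^3 / (6 * h) + \<tau>\<^sup>2 / 4) *\<^sub>R \<delta>)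
      has_vector_derivative f1 (s + t) - (f1 s + (t / h) *\<^sub>R ?w) - (t\<^sup>2 / (2 * h) + t / 2) *\<^sub>R \<delta>) (at t within {0..h})"
    by (rule has_vector_derivative_eq_rhs[OF di[OF di[OF sh[OF f[OF st]]
            ad[OF ad[OF co sc[OF p(1)]] sc[OF p(2)]]] sc[OF p(3)]]]) simp
  show "((\<lambda>t. f1 (s + t) - (f1 s + (t / h) *\<^sub>R ?w) - (t\<^sup>2 / (2 * h) + t / 2) *\<^sub>R \<delta>) has_vector_derivative
      f2 (s + t) - (1 / h) *\<^sub>R ?w - (t / h + 1 / 2) *\<^sub>R \<delta>) (at t within {0..h})"
    by (rule has_vector_derivative_eq_rhs[OF di[OF di[OF sh[OF f1[OF st]]
            ad[OF co sc[OF p(4)]]] sc[OF p(5)]]]) simp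
  let ?x = "s + t"
  \<comment> \<open>The derivative of \<open>g\<close> is the quantity bounded in the hypothesis, so the increment of \<open>g\<close> over
    \<open>[s - h, s]\<close> averages that hypothesis over the interval.\<close>
  define g where "g r = f1 r - r *\<^sub>R f2 ?x + ((?x * r - r\<^sup>2 / 2) / h) *\<^sub>R \<delta>" for r
  have "norm (g s - g (s - h)) \<le> \<eta> * \<bar>s - (s - h)\<bar>"
  proof (rule vector_derivative_norm_bound[where a="s-h" and b="s+h"])
    fix r assume r: "r \<in> {s-h..s+h}"
    have pr: "((\<lambda>r. r) has_real_derivative 1) (at r within {s-h..s+h})"
      "((\<lambda>r. (?x * r - r\<^sup>2 / 2) / h) has_real_derivative (?x - r) / h) (at r within {s-h..s+h})"
      using \<open>0 < h\<close> by (auto intro!: derivative_eq_intros simp: field_simps)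
    show "(g has_vector_derivative f2 r - f2 ?x - ((r - ?x) / h) *\<^sub>R \<delta>) (at r within {s-h..s+h})"
      unfolding g_def
      by (rule has_vector_derivative_eq_rhs[OF ad[OF di[OF f1[OF r] sc[OF pr(1)]] sc[OF pr(2)]]])
         (use \<open>0 < h\<close> in \<open>simp add: diff_divide_distrib algebra_simps\<close>)
    show "norm (f2 r - f2 ?x - ((r - ?x) / h) *\<^sub>R \<delta>) \<le> \<eta>"
      by (rule f2[OF r st])
  qed (use \<open>0 < h\<close> in auto)
  then have gb: "norm (g s - g (s - h)) \<le> \<eta> * h" using \<open>0 < h\<close> by simp
  have "g s - g (s - h) = ?w - h *\<^sub>R f2 ?x + (((?x * s - s\<^sup>2 / 2) / h) - ((?x * (s - h) - (s - h)\<^sup>2 / 2) / h)) *\<^sub>R \<delta>"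
    by (simp add: g_def algebra_simps)
  also have "((?x * s - s\<^sup>2 / 2) / h) - ((?x * (s - h) - (s - h)\<^sup>2 / 2) / h) = t + h / 2"
    using \<open>0 < h\<close> by (simp add: field_simps power2_eq_square)
  finally have eq: "g s - g (s - h) = ?w - h *\<^sub>R f2 ?x + (t + h / 2) *\<^sub>R \<delta>" .
  have "f2 ?x - (1 / h) *\<^sub>R ?w - (t / h + 1 / 2) *\<^sub>R \<delta> = - (1 / h) *\<^sub>R (g s - g (s - h))"
    unfolding eq using \<open>0 < h\<close> by (simp add: algebra_simps add_divide_distrib)
  then have "norm (f2 ?x - (1 / h) *\<^sub>R ?w - (t / h + 1 / 2) *\<^sub>R \<delta>) = norm (g s - g (s - h)) / h"
    using \<open>0 < h\<close> by simp
  also have "\<dots> \<le> \<eta>" using gb \<open>0 < h\<close> by (simp add: field_simps)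
  finally show "norm (f2 ?x - (1 / h) *\<^sub>R ?w - (t / h + 1 / 2) *\<^sub>R \<delta>) \<le> \<eta>" .
qed (use \<tau> in auto)

section \<open>The matrix cosine and sine\<close>

lemma bounded_bilinear_matrix_vector_mult:
  "bounded_bilinear ((*v) :: complex^'n^'m \<Rightarrow> complex^'n \<Rightarrow> complex^'m)"
  unfolding bilinear_conv_bounded_bilinear[symmetric] bilinear_def
  by (auto intro!: linearI simp:
      matrix_vector_mult_def vec_eq_iff scaleR_sum_right sum.distrib algebra_simps)

lemma bounded_bilinear_matrix_matrix_mult:
  "bounded_bilinear ((**) :: complex^'n^'m \<Rightarrow> complex^'p^'n \<Rightarrow> complex^'p^'m)"
  unfolding bilinear_conv_bounded_bilinear[symmetric] bilinear_def
  by (auto intro!: linearI simp: matrix_matrix_mult_def vec_eq_iff scaleR_sum_right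
      sum.distrib algebra_simps)

lemma norm_vec_times_le: "norm (x * y) \<le> norm x * norm y" for x y :: "complex^'n"
proof -
  have "norm (x * y) \<le> L2_set (\<lambda>i. norm x * norm (y $ i)) UNIV"
    unfolding norm_vec_def[of "x * y"]
    by (intro L2_set_mono) (auto simp: norm_mult Finite_Cartesian_Product.norm_nth_le mult_right_mono)
  also have "\<dots> = norm x * norm y"
    by (simp add: norm_vec_def[of y] L2_set_right_distrib)
  finally show ?thesis .
qed

lemma bounded_bilinear_vec_times: "bounded_bilinear ((*) :: complex^'n \<Rightarrow> complex^'n \<Rightarrow> complex^'n)"
  by (rule bounded_bilinear.intro)
     (auto simp: algebra_simps intro!: exI[of _ 1] norm_vec_times_le)

lemma mat_power_Suc: "mat_power A (Suc n) = A ** mat_power A n"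
  by (simp add: mat_power_def)

lemma mat_power_0: "mat_power A 0 = mat 1"
  by (simp add: mat_power_def)

lemma mat_power_commute: "mat_power A n ** A = A ** mat_power A n"
  by (induction n) (simp_all add: mat_power_Suc mat_power_0 matrix_mul_assoc[symmetric])

lemma mat_power_scaleR: "mat_power (t *\<^sub>R A) n = t ^ n *\<^sub>R mat_power A n"
  by (induction n) (simp_all add: mat_power_Suc mat_power_0
      bounded_bilinear.scaleR_left[OF bounded_bilinear_matrix_matrix_mult]
      bounded_bilinear.scaleR_right[OF bounded_bilinear_matrix_matrix_mult])

text \<open>
  The coefficients of the cosine and sine series are dominated by those of the exponential series.
\<close>

lemma summable_mat_power_series:
  fixes A :: "complex^'n^'n"
  assumes e: "\<And>n. \<bar>e n\<bar> \<le> 1 / fact n"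
  shows "summable (\<lambda>n. t ^ n *\<^sub>R (e n *\<^sub>R mat_power A n))"
proof -
  obtain k where k: "k > 0" "\<And>(X::complex^'n^'n) (Y::complex^'n^'n). norm (X ** Y) \<le> norm X * norm Y * k"
    using bounded_bilinear.pos_bounded[OF bounded_bilinear_matrix_matrix_mult] by blast
  let ?I = "mat 1 :: complex^'n^'n"
  have pw: "norm (mat_power A n) \<le> norm ?I * (norm A * k) ^ n" for n
  proof (induction n)
    case (Suc n)
    have "norm (mat_power A (Suc n)) \<le> norm A * norm (mat_power A n) * k"
      by (simp add: mat_power_Suc k)
    also have "\<dots> \<le> norm A * (norm ?I * (norm A * k) ^ n) * k"
      using Suc k(1) by (intro mult_left_mono mult_right_mono) auto
    finally show ?case by (simp add: mult_ac)
  qed (simp add: mat_power_0)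
  show ?thesis
  proof (rule summable_comparison_test'[where N=0])
    show "summable (\<lambda>n. norm ?I * (inverse (fact n) * (\<bar>t\<bar> * (norm A * k)) ^ n))"
      by (intro summable_mult summable_exp)
    fix n
    have "norm (t ^ n *\<^sub>R (e n *\<^sub>R mat_power A n)) = \<bar>t\<bar> ^ n * (\<bar>e n\<bar> * norm (mat_power A n))"
      by (simp add: power_abs abs_mult)
    also have "\<dots> \<le> \<bar>t\<bar> ^ n * (1 / fact n * (norm ?I * (norm A * k) ^ n))"
      by (intro mult_left_mono mult_mono e pw) auto
    finally show "norm (t ^ n *\<^sub>R (e n *\<^sub>R mat_power A n))
        \<le> norm ?I * (inverse (fact n) * (\<bar>t\<bar> * (norm A * k)) ^ n)"
      by (simp add: power_mult_distrib field_simps)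
  qed
qed

lemma abs_cos_coeff_le: "\<bar>cos_coeff n\<bar> \<le> 1 / fact n"
  by (auto simp: cos_coeff_def power_abs)

lemma abs_sin_coeff_le: "\<bar>sin_coeff n\<bar> \<le> 1 / fact n"
  by (auto simp: sin_coeff_def power_abs)

text \<open>
  Written over all powers, with vanishing coefficients, the series can be differentiated term by
  term with the rules for the scalar coefficients.
\<close>

lemma mat_cos_scaleR: "mat_cos (t *\<^sub>R A) = (\<Sum>n. t ^ n *\<^sub>R (cos_coeff n *\<^sub>R mat_power A n))"
proof -
  let ?f = "\<lambda>n. t ^ n *\<^sub>R (cos_coeff n *\<^sub>R mat_power A n)"
  have "?f sums suminf ?f"
    by (intro summable_sums summable_mat_power_series abs_cos_coeff_le)
  moreover have "strict_mono (\<lambda>k::nat. 2 * k)" by (simp add: strict_mono_def)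
  moreover have "?f n = 0" if "n \<notin> range (\<lambda>k::nat. 2 * k)" for n
    using that by (auto simp: cos_coeff_def elim!: evenE)
  ultimately have "(\<lambda>k. ?f (2 * k)) sums suminf ?f"
    using sums_mono_reindex[of "\<lambda>k::nat. 2 * k" ?f "suminf ?f"] by blast
  then show ?thesis
    unfolding mat_cos_def by (auto simp: cos_coeff_def mat_power_scaleR sums_iff mult_ac)
qed

lemma mat_sin_scaleR: "mat_sin (t *\<^sub>R A) = (\<Sum>n. t ^ n *\<^sub>R (sin_coeff n *\<^sub>R mat_power A n))"
proof -
  let ?f = "\<lambda>n. t ^ n *\<^sub>R (sin_coeff n *\<^sub>R mat_power A n)"
  have "?f sums suminf ?f"
    by (intro summable_sums summable_mat_power_series abs_sin_coeff_le)
  moreover have "strict_mono (\<lambda>k::nat. 2 * k + 1)" by (simp add: strict_mono_def)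
  moreover have "?f n = 0" if "n \<notin> range (\<lambda>k::nat. 2 * k + 1)" for n
    using that by (auto simp: sin_coeff_def elim!: oddE)
  ultimately have "(\<lambda>k. ?f (2 * k + 1)) sums suminf ?f"
    using sums_mono_reindex[of "\<lambda>k::nat. 2 * k + 1" ?f "suminf ?f"] by blast
  then show ?thesis
    unfolding mat_sin_def by (auto simp: sin_coeff_def mat_power_scaleR sums_iff mult_ac)
qed

text \<open>
  Each coordinate is a scalar power series.
\<close>

lemma power_series_has_vector_derivative:
  fixes c :: "nat \<Rightarrow> 'a::euclidean_space"
  assumes c: "\<And>t::real. summable (\<lambda>n. t ^ n *\<^sub>R c n)"
    and d: "\<And>t::real. summable (\<lambda>n. t ^ n *\<^sub>R (real (Suc n) *\<^sub>R c (Suc n)))"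
  shows "((\<lambda>t. \<Sum>n. t ^ n *\<^sub>R c n) has_vector_derivative
           (\<Sum>n. t ^ n *\<^sub>R (real (Suc n) *\<^sub>R c (Suc n)))) (at t)"
  unfolding has_vector_derivative_def
proof (subst has_derivative_componentwise_within, rule ballI)
  fix b :: 'a assume "b \<in> Basis"
  have inner: "suminf f \<bullet> b = (\<Sum>n. f n \<bullet> b)" "summable (\<lambda>n. f n \<bullet> b)" if "summable f" for f :: "nat \<Rightarrow> 'a"
    using bounded_linear.suminf[OF bounded_linear_inner_left that]
      bounded_linear.summable[OF bounded_linear_inner_left that] by auto
  have "summable (\<lambda>n. (c n \<bullet> b) * y ^ n)" for y :: real
    using inner(2)[OF c[of y]] by (simp add: mult.commute)
  then have "((\<lambda>x. \<Sum>n. (c n \<bullet> b) * x ^ n) has_field_derivative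
      (\<Sum>n. diffs (\<lambda>n. c n \<bullet> b) n * t ^ n)) (at t)"
    by (rule termdiffs_strong_converges_everywhere)
  moreover have "(\<lambda>x. \<Sum>n. (c n \<bullet> b) * x ^ n) = (\<lambda>x. (\<Sum>n. x ^ n *\<^sub>R c n) \<bullet> b)"
    by (auto simp: inner(1)[OF c] mult.commute)
  moreover have "(\<Sum>n. diffs (\<lambda>n. c n \<bullet> b) n * t ^ n)
      = (\<Sum>n. t ^ n *\<^sub>R (real (Suc n) *\<^sub>R c (Suc n))) \<bullet> b"
    by (subst inner(1)[OF d]) (simp add: diffs_def algebra_simps)
  ultimately show "((\<lambda>t. (\<Sum>n. t ^ n *\<^sub>R c n) \<bullet> b) has_derivative
      (\<lambda>x. (x *\<^sub>R (\<Sum>n. t ^ n *\<^sub>R (real (Suc n) *\<^sub>R c (Suc n)))) \<bullet> b)) (at t)"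
    by (simp add: has_field_derivative_def mult.commute[of _ "_ \<bullet> b"] cong: if_cong)
qed

lemma matrix_mult_suminf:
  fixes A :: "complex^'n^'n" and f :: "nat \<Rightarrow> complex^'n^'n"
  assumes "summable f"
  shows "A ** suminf f = (\<Sum>n. A ** f n)" "suminf f ** A = (\<Sum>n. f n ** A)"
    "summable (\<lambda>n. A ** f n)"
  using bounded_linear.suminf[OF bounded_bilinear.bounded_linear_right[OF bounded_bilinear_matrix_matrix_mult] assms]
    bounded_linear.suminf[OF bounded_bilinear.bounded_linear_left[OF bounded_bilinear_matrix_matrix_mult] assms]
    bounded_linear.summable[OF bounded_bilinear.bounded_linear_right[OF bounded_bilinear_matrix_matrix_mult] assms]
  by auto

lemmas matrix_mult_scaleR =
  bounded_bilinear.scaleR_left[OF bounded_bilinear_matrix_matrix_mult]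
  bounded_bilinear.scaleR_right[OF bounded_bilinear_matrix_matrix_mult]

lemma mat_sin_commute: "mat_sin (t *\<^sub>R A) ** A = A ** mat_sin (t *\<^sub>R A)"
  unfolding mat_sin_scaleR
    matrix_mult_suminf(1,2)[OF summable_mat_power_series[OF abs_sin_coeff_le]]
  by (simp add: matrix_mult_scaleR mat_power_commute)

lemma mat_cos_commute: "mat_cos (t *\<^sub>R A) ** A = A ** mat_cos (t *\<^sub>R A)"
  unfolding mat_cos_scaleR
    matrix_mult_suminf(1,2)[OF summable_mat_power_series[OF abs_cos_coeff_le]]
  by (simp add: matrix_mult_scaleR mat_power_commute)

lemma Suc_cos_coeff: "real (Suc n) * cos_coeff (Suc n) = - sin_coeff n"
  using fun_cong[OF diffs_cos_coeff, of n] by (simp add: diffs_def)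

lemma Suc_sin_coeff: "real (Suc n) * sin_coeff (Suc n) = cos_coeff n"
  using fun_cong[OF diffs_sin_coeff, of n] by (simp add: diffs_def)

lemma mat_cos_has_vector_derivative:
  "((\<lambda>t. mat_cos (t *\<^sub>R A)) has_vector_derivative - (A ** mat_sin (t *\<^sub>R A))) (at t)"
proof -
  have *: "real (Suc n) *\<^sub>R (cos_coeff (Suc n) *\<^sub>R mat_power A (Suc n)) = - (A ** (sin_coeff n *\<^sub>R mat_power A n))" for n
    by (simp only: scaleR_scaleR Suc_cos_coeff mat_power_Suc matrix_mult_scaleR) simp
  have eq: "t ^ n *\<^sub>R (real (Suc n) *\<^sub>R (cos_coeff (Suc n) *\<^sub>R mat_power A (Suc n)))
      = - (A ** (t ^ n *\<^sub>R (sin_coeff n *\<^sub>R mat_power A n)))" for n t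
    unfolding * by (simp add: matrix_mult_scaleR)
  note sm = summable_mat_power_series[OF abs_sin_coeff_le, of _ A]
  have "((\<lambda>t. \<Sum>n. t ^ n *\<^sub>R (cos_coeff n *\<^sub>R mat_power A n)) has_vector_derivative
      (\<Sum>n. t ^ n *\<^sub>R (real (Suc n) *\<^sub>R (cos_coeff (Suc n) *\<^sub>R mat_power A (Suc n))))) (at t)"
    by (rule power_series_has_vector_derivative)
       (auto simp only: eq intro!: summable_minus summable_mat_power_series abs_cos_coeff_le matrix_mult_suminf(3) sm)
  moreover have "(\<Sum>n. - (A ** (t ^ n *\<^sub>R (sin_coeff n *\<^sub>R mat_power A n)))) = - (A ** mat_sin (t *\<^sub>R A))"
    unfolding mat_sin_scaleR matrix_mult_suminf(1)[OF sm]
    by (intro suminf_minus matrix_mult_suminf(3) sm)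
  ultimately show ?thesis unfolding mat_cos_scaleR eq by simp
qed

lemma mat_sin_has_vector_derivative:
  "((\<lambda>t. mat_sin (t *\<^sub>R A)) has_vector_derivative (A ** mat_cos (t *\<^sub>R A))) (at t)"
proof -
  have *: "real (Suc n) *\<^sub>R (sin_coeff (Suc n) *\<^sub>R mat_power A (Suc n)) = A ** (cos_coeff n *\<^sub>R mat_power A n)" for n
    by (simp only: scaleR_scaleR Suc_sin_coeff mat_power_Suc matrix_mult_scaleR)
  have eq: "t ^ n *\<^sub>R (real (Suc n) *\<^sub>R (sin_coeff (Suc n) *\<^sub>R mat_power A (Suc n)))
      = A ** (t ^ n *\<^sub>R (cos_coeff n *\<^sub>R mat_power A n))" for n t
    unfolding * by (simp add: matrix_mult_scaleR)
  note sm = summable_mat_power_series[OF abs_cos_coeff_le, of _ A]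
  have "((\<lambda>t. \<Sum>n. t ^ n *\<^sub>R (sin_coeff n *\<^sub>R mat_power A n)) has_vector_derivative
      (\<Sum>n. t ^ n *\<^sub>R (real (Suc n) *\<^sub>R (sin_coeff (Suc n) *\<^sub>R mat_power A (Suc n))))) (at t)"
    by (rule power_series_has_vector_derivative)
       (auto simp only: eq intro!: summable_mat_power_series abs_sin_coeff_le matrix_mult_suminf(3) sm)
  then show ?thesis unfolding mat_sin_scaleR eq mat_cos_scaleR matrix_mult_suminf(1)[OF sm] .
qed

lemma mat_cos_0: "mat_cos (0 *\<^sub>R A) = mat 1"
  unfolding mat_cos_scaleR by (subst suminf_finite[of "{0}"]) (auto simp: mat_power_0)

lemma mat_sin_0: "mat_sin (0 *\<^sub>R A) = 0"
  unfolding mat_sin_scaleR by (subst suminf_finite[of "{0}"]) auto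

lemma Lipschitz_at_0_matrix:
  fixes F :: "real \<Rightarrow> complex^'n^'m"
  assumes F: "\<And>t. (F has_vector_derivative F' t) (at t)" and "continuous_on {0..H} F'"
  shows "\<exists>c\<ge>0. \<forall>t\<in>{0..H}. \<forall>x. norm (F t *v x - F 0 *v x) \<le> c * t * norm x"
proof -
  obtain k where k: "k > 0"
    "\<And>(X::complex^'n^'m) Y. norm (X *v Y) \<le> norm X * norm Y * k"
    using bounded_bilinear.pos_bounded[OF bounded_bilinear_matrix_vector_mult] by blast
  have "compact (F' ` {0..H})"
    using assms by (intro compact_continuous_image) auto
  then obtain b where b: "0 < b" "\<And>t. t \<in> {0..H} \<Longrightarrow> norm (F' t) \<le> b"
    using bounded_pos[of "F' ` {0..H}"] compact_imp_bounded by auto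
  have "norm (F t *v x - F 0 *v x) \<le> (b * k) * t * norm x" if t: "t \<in> {0..H}" for t x
  proof -
    have "norm (F t - F 0) \<le> b * \<bar>t - 0\<bar>"
      using t by (intro vector_derivative_norm_bound[of 0 H F F'])
        (auto intro: b has_vector_derivative_at_within F)
    then have "norm (F t - F 0) * norm x * k \<le> b * t * norm x * k"
      using t k(1) by (intro mult_right_mono) auto
    moreover have "norm ((F t - F 0) *v x) \<le> norm (F t - F 0) * norm x * k"
      by (rule k)
    ultimately show ?thesis
      by (simp add: matrix_vector_mult_diff_rdistrib mult_ac)
  qed
  then show ?thesis using b k by (intro exI[of _ "b * k"]) auto
qed

lemma continuous_on_mat_cos: "continuous_on S (\<lambda>t. mat_cos (t *\<^sub>R A))"
  by (rule continuous_on_vector_derivative[OF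
        has_vector_derivative_at_within[OF mat_cos_has_vector_derivative]])

lemma continuous_on_mat_sin: "continuous_on S (\<lambda>t. mat_sin (t *\<^sub>R A))"
  by (rule continuous_on_vector_derivative[OF
        has_vector_derivative_at_within[OF mat_sin_has_vector_derivative]])

lemmas has_vector_derivative_matrix_mult =
  bounded_linear.has_vector_derivative[OF bounded_bilinear.bounded_linear_right[OF bounded_bilinear_matrix_matrix_mult]]

lemmas continuous_on_matrix_mult =
  bounded_bilinear.continuous_on[OF bounded_bilinear_matrix_matrix_mult]

text \<open>
  Stability and the size of the local errors are read off from these bounds; \<open>c\<close> depends on the
  matrices and on the length of the time interval alone, which makes the later constants uniform.
\<close>

lemma propagator_bounds:
  fixes G L :: "complex^'x^'x"
  assumes "0 \<le> H"
  obtains c where "0 \<le> c"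
    "\<And>t x. t \<in> {0..H} \<Longrightarrow> norm (mat_cos (t *\<^sub>R G) *v x - x) \<le> c * t * norm x"
    "\<And>t x. t \<in> {0..H} \<Longrightarrow> norm ((matrix_inv G ** mat_sin (t *\<^sub>R G)) *v x) \<le> c * t * norm x"
    "\<And>t x. t \<in> {0..H} \<Longrightarrow> norm ((G ** mat_sin (t *\<^sub>R G)) *v x) \<le> c * t * norm x"
    "\<And>x. norm (L *v x) \<le> c * norm x"
proof -
  have z: "(A ** (0::complex^'x^'x)) *v x = 0" for A :: "complex^'x^'x" and x
    by (simp add: matrix_matrix_mult_def matrix_vector_mult_def vec_eq_iff)
  have "\<exists>c\<ge>0. \<forall>t\<in>{0..H}. \<forall>x.
      norm (mat_cos (t *\<^sub>R G) *v x - mat_cos (0 *\<^sub>R G) *v x) \<le> c * t * norm x"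
    by (rule Lipschitz_at_0_matrix[OF mat_cos_has_vector_derivative])
       (intro continuous_on_minus continuous_on_matrix_mult continuous_on_const continuous_on_mat_sin)
  then obtain c1 where c1: "0 \<le> c1" "\<And>t x. t \<in> {0..H} \<Longrightarrow>
      norm (mat_cos (t *\<^sub>R G) *v x - mat_cos (0 *\<^sub>R G) *v x) \<le> c1 * t * norm x"
    by blast
  have *: "\<exists>c\<ge>0. \<forall>t\<in>{0..H}. \<forall>x.
      norm ((A ** mat_sin (t *\<^sub>R G)) *v x - (A ** mat_sin (0 *\<^sub>R G)) *v x) \<le> c * t * norm x"
    for A :: "complex^'x^'x"
    by (rule Lipschitz_at_0_matrix[OF has_vector_derivative_matrix_mult[OF mat_sin_has_vector_derivative]])
       (intro continuous_on_matrix_mult continuous_on_const continuous_on_mat_cos)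
  obtain c2 where c2: "0 \<le> c2" "\<And>t x. t \<in> {0..H} \<Longrightarrow>
      norm ((matrix_inv G ** mat_sin (t *\<^sub>R G)) *v x) \<le> c2 * t * norm x"
    using *[of "matrix_inv G"] unfolding mat_sin_0 z by auto
  obtain c3 where c3: "0 \<le> c3" "\<And>t x. t \<in> {0..H} \<Longrightarrow>
      norm ((G ** mat_sin (t *\<^sub>R G)) *v x) \<le> c3 * t * norm x"
    using *[of G] unfolding mat_sin_0 z by auto
  obtain c4 where c4: "0 < c4" "\<And>x. norm (L *v x) \<le> norm x * c4"
    using bounded_linear.pos_bounded[OF bounded_bilinear.bounded_linear_right[OF bounded_bilinear_matrix_vector_mult, of L]]
    by blast
  define c where "c = c1 + c2 + c3 + c4"
  have up: "c' * t * norm x \<le> c * t * norm x" if "c' \<le> c" "t \<in> {0..H}" for c' t and x :: "complex^'x"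
    using that by (intro mult_right_mono) auto
  show thesis
  proof (rule that[of c])
    fix t x assume t: "t \<in> {0..H}"
    show "norm (mat_cos (t *\<^sub>R G) *v x - x) \<le> c * t * norm x"
      using c1(2)[OF t, of x] up[of c1 t x] t c1(1) c2(1) c3(1) c4(1) unfolding mat_cos_0 by (simp add: c_def)
    show "norm ((matrix_inv G ** mat_sin (t *\<^sub>R G)) *v x) \<le> c * t * norm x"
      using c2(2)[OF t, of x] up[of c2 t x] t c1(1) c2(1) c3(1) c4(1) by (simp add: c_def)
    show "norm ((G ** mat_sin (t *\<^sub>R G)) *v x) \<le> c * t * norm x"
      using c3(2)[OF t, of x] up[of c3 t x] t c1(1) c2(1) c3(1) c4(1) by (simp add: c_def)
  next
    fix x
    show "norm (L *v x) \<le> c * norm x"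
      using c4(2)[of x] mult_right_mono[of c4 c "norm x"] c1(1) c2(1) c3(1) by (simp add: c_def mult.commute)
  qed (use c1 c2 c3 c4 in \<open>simp add: c_def\<close>)
qed

section \<open>Bounds on the data and on the solution\<close>

lemma mass_continuous:
  assumes "nonoscillatory_coeffs t0 T N A a"
  shows "continuous_on {t0..T} (mass N \<omega> a)"
proof -
  have a: "continuous_on {t0..T} (a n)" if n: "n \<in> {1..N}" for n
  proof -
    obtain a' where "\<And>t. t \<in> {t0..T} \<Longrightarrow> (a n has_vector_derivative a' t) (at t within {t0..T})"
      using assms n unfolding nonoscillatory_coeffs_def by blast
    then show ?thesis by (rule continuous_on_vector_derivative)
  qed
  show ?thesis
    unfolding mass_def by (intro continuous_intros a)
qed

lemma mass_bound:
  fixes a :: "nat \<Rightarrow> real \<Rightarrow> complex^'x"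
  assumes "nonoscillatory_coeffs t0 T N A a" "t \<in> {t0..T}"
  shows "norm (mass N \<omega> a t) \<le> real CARD('x) * (real N * \<bar>A\<bar>)"
proof -
  have "norm (mass N \<omega> a t $ x) \<le> real N * \<bar>A\<bar>" for x
  proof -
    have "norm (mass N \<omega> a t $ x) \<le> (\<Sum>n=1..N. norm (a n t $ x * exp (\<i> * of_real (\<omega> n * t))))"
      by (simp add: mass_def norm_sum)
    also have "\<dots> \<le> (\<Sum>n=1..N. \<bar>A\<bar>)"
    proof (rule sum_mono)
      fix n assume "n \<in> {1..N}"
      then have "norm (a n t $ x) \<le> A"
        using assms unfolding nonoscillatory_coeffs_def by blast
      then show "norm (a n t $ x * exp (\<i> * of_real (\<omega> n * t))) \<le> \<bar>A\<bar>"
        by (simp add: norm_mult)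
    qed
    finally show ?thesis by simp
  qed
  then have "(\<Sum>x\<in>UNIV. norm (mass N \<omega> a t $ x)) \<le> (\<Sum>x\<in>(UNIV::'x set). real N * \<bar>A\<bar>)"
    by (intro sum_mono)
  moreover have "norm (mass N \<omega> a t) \<le> (\<Sum>x\<in>UNIV. norm (mass N \<omega> a t $ x))"
    unfolding norm_vec_def by (rule L2_set_le_sum) simp
  ultimately show ?thesis by simp
qed

lemma pos_definite_matrix_inv:
  fixes G :: "complex^'x^'x"
  assumes "pos_definite G"
  shows "matrix_inv G ** G = mat 1"
proof -
  have "x = 0" if "G *v x = 0" for x
  proof (rule ccontr)
    assume "x \<noteq> 0"
    then have "0 < Re (\<Sum>i\<in>UNIV. cnj (x $ i) * (G *v x) $ i)"
      using assms unfolding pos_definite_def by blast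
    then show False using that by simp
  qed
  then have "\<exists>B. B ** G = mat 1" by (simp add: matrix_left_invertible_ker)
  then have "\<exists>B. G ** B = mat 1 \<and> B ** G = mat 1" by (metis matrix_left_right_inverse)
  from someI_ex[OF this] show ?thesis
    by (simp add: matrix_inv_def)
qed

text \<open>
  The derivative of \<open>|\<psi>|\<^sup>2 + |\<psi>'|\<^sup>2\<close> is at most \<open>1 + c + B\<close> times that quantity.  The bound
  depends on \<open>m\<close> through \<open>B\<close> only, so it does not see the frequencies.
\<close>

lemma KG_solution_bound:
  assumes sol: "KG_solution L m t0 T u v \<psi> \<psi>1 \<psi>2 \<psi>3"
    and m: "\<And>t. t \<in> {t0..T} \<Longrightarrow> norm (m t) \<le> B"
    and L: "\<And>x. norm (L *v x) \<le> c * norm x"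
    and c: "0 \<le> c" "0 \<le> B"
    and t: "t \<in> {t0..T}"
  defines "R \<equiv> sqrt (((norm u)\<^sup>2 + (norm v)\<^sup>2) * exp ((1 + c + B) * (T - t0)))"
  shows "norm (\<psi> t) \<le> R" "norm (\<psi>1 t) \<le> R" "norm (\<psi>2 t) \<le> (c + B) * R"
proof -
  let ?k = "1 + c + B"
  define y where "y s = \<psi> s \<bullet> \<psi> s + \<psi>1 s \<bullet> \<psi>1 s" for s
  define w where "w s = y s * exp (- (?k * (s - t0)))" for s
  have d0: "(\<psi> has_vector_derivative \<psi>1 s) (at s within {t0..T})"
    and d1: "(\<psi>1 has_vector_derivative \<psi>2 s) (at s within {t0..T})"
    and eq: "\<psi>2 s = L *v \<psi> s + m s * \<psi> s" if "s \<in> {t0..T}" for s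
    using sol that unfolding KG_solution_def by blast+
  have p2: "norm (\<psi>2 s) \<le> (c + B) * norm (\<psi> s)" if s: "s \<in> {t0..T}" for s
  proof -
    have "norm (\<psi>2 s) \<le> c * norm (\<psi> s) + norm (m s) * norm (\<psi> s)"
      unfolding eq[OF s] by (intro norm_triangle_le add_mono L norm_vec_times_le)
    also have "norm (m s) * norm (\<psi> s) \<le> B * norm (\<psi> s)"
      by (intro mult_right_mono m s) auto
    finally show ?thesis by (simp add: algebra_simps)
  qed
  have yd: "(y has_vector_derivative 2 * (\<psi> s \<bullet> \<psi>1 s) + 2 * (\<psi>1 s \<bullet> \<psi>2 s)) (at s within {t0..T})"
    if s: "s \<in> {t0..T}" for s
    unfolding y_def
    by (rule has_vector_derivative_eq_rhs[OF has_vector_derivative_add[OF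
          bounded_bilinear.has_vector_derivative[OF bounded_bilinear_inner d0[OF s] d0[OF s]]
          bounded_bilinear.has_vector_derivative[OF bounded_bilinear_inner d1[OF s] d1[OF s]]]])
       (simp add: inner_commute)
  have wd: "(w has_real_derivative
      (2 * (\<psi> s \<bullet> \<psi>1 s) + 2 * (\<psi>1 s \<bullet> \<psi>2 s) - ?k * y s) * exp (- (?k * (s - t0)))) (at s within {t0..T})"
    if s: "s \<in> {t0..T}" for s
    unfolding w_def
    by (rule derivative_eq_intros refl yd[OF s, folded has_real_derivative_iff_has_vector_derivative])+
       (simp add: algebra_simps)
  have nonpos: "2 * (\<psi> s \<bullet> \<psi>1 s) + 2 * (\<psi>1 s \<bullet> \<psi>2 s) - ?k * y s \<le> 0" if s: "s \<in> {t0..T}" for s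
  proof -
    let ?a = "norm (\<psi> s)" and ?b = "norm (\<psi>1 s)"
    have am: "2 * (?a * ?b) \<le> ?a\<^sup>2 + ?b\<^sup>2"
      using sum_squares_bound[of ?a ?b] by simp
    have "\<psi> s \<bullet> \<psi>1 s \<le> ?a * ?b" by (rule norm_cauchy_schwarz)
    moreover have "\<psi>1 s \<bullet> \<psi>2 s \<le> (c + B) * (?a * ?b)"
      using norm_cauchy_schwarz[of "\<psi>1 s" "\<psi>2 s"] mult_left_mono[OF p2[OF s], of ?b]
      by (simp add: mult_ac)
    ultimately have "2 * (\<psi> s \<bullet> \<psi>1 s) + 2 * (\<psi>1 s \<bullet> \<psi>2 s) \<le> ?k * (2 * (?a * ?b))"
      by (simp add: algebra_simps)
    also have "\<dots> \<le> ?k * (?a\<^sup>2 + ?b\<^sup>2)"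
      using c by (intro mult_left_mono am) auto
    finally show ?thesis by (simp add: y_def power2_norm_eq_inner)
  qed
  have "w t \<le> w t0"
  proof (cases "t0 = t")
    case False
    with t have "t0 < t" by simp
    have "\<exists>x\<in>{t0..t}. w t - w t0 = (\<lambda>h. h * ((2 * (\<psi> x \<bullet> \<psi>1 x) + 2 * (\<psi>1 x \<bullet> \<psi>2 x) - ?k * y x) * exp (- (?k * (x - t0))))) (t - t0)"
    proof (rule mvt_very_simple)
      fix x assume x: "t0 \<le> x" "x \<le> t"
      then have "x \<in> {t0..T}" using t by auto
      from wd[OF this] show "(w has_derivative (\<lambda>h. h * ((2 * (\<psi> x \<bullet> \<psi>1 x) + 2 * (\<psi>1 x \<bullet> \<psi>2 x) - ?k * y x) * exp (- (?k * (x - t0))))))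
          (at x within {t0..t})"
        using t by (auto simp: has_field_derivative_def mult.commute[of _ "_ * exp _"]
            intro: has_derivative_subset)
    qed (use \<open>t0 < t\<close> in simp)
    then obtain x where "x \<in> {t0..t}" "w t - w t0 = (t - t0) * ((2 * (\<psi> x \<bullet> \<psi>1 x) + 2 * (\<psi>1 x \<bullet> \<psi>2 x) - ?k * y x) * exp (- (?k * (x - t0))))"
      by auto
    moreover from this have "(t - t0) * ((2 * (\<psi> x \<bullet> \<psi>1 x) + 2 * (\<psi>1 x \<bullet> \<psi>2 x) - ?k * y x) * exp (- (?k * (x - t0)))) \<le> 0"
      using nonpos[of x] t by (intro mult_nonneg_nonpos mult_nonpos_nonneg) auto
    ultimately show ?thesis by linarith
  qed simp
  then have "y t * exp (- (?k * (t - t0))) * exp (?k * (t - t0)) \<le> y t0 * exp (?k * (t - t0))"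
    by (simp add: w_def)
  then have "y t \<le> y t0 * exp (?k * (t - t0))"
    by (simp add: mult.assoc flip: exp_add)
  also have "\<dots> \<le> y t0 * exp (?k * (T - t0))"
    using t c by (intro mult_left_mono) (auto simp: y_def intro: mult_left_mono)
  also have "y t0 = (norm u)\<^sup>2 + (norm v)\<^sup>2"
    using sol by (simp add: y_def KG_solution_def power2_norm_eq_inner)
  finally have *: "(norm (\<psi> t))\<^sup>2 + (norm (\<psi>1 t))\<^sup>2 \<le> R\<^sup>2"
    by (simp add: R_def y_def power2_norm_eq_inner)
  have R: "0 \<le> R" by (simp add: R_def)
  show "norm (\<psi> t) \<le> R"
    by (rule power2_le_imp_le[OF _ R]) (use * zero_le_power2[of "norm (\<psi>1 t)"] in linarith)
  then show "norm (\<psi>2 t) \<le> (c + B) * R"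
    using p2[OF t] mult_left_mono[of "norm (\<psi> t)" R "c + B"] c by linarith
  show "norm (\<psi>1 t) \<le> R"
    by (rule power2_le_imp_le[OF _ R]) (use * zero_le_power2[of "norm (\<psi> t)"] in linarith)
qed

section \<open>Stability of two-step recursions\<close>

text \<open>
  The sequence \<open>b\<close> absorbs the part of the perturbations that telescopes: it costs its own size
  instead of the sum of the sizes of its increments.  For \<open>k = 0\<close> the predecessor \<open>k - 1\<close> is again \<open>0\<close>,
  where \<open>z\<close> vanishes, so a first step of a different kind fits the same recursion.
\<close>

lemma two_step_Gronwall:
  fixes z b :: "nat \<Rightarrow> 'a::real_normed_vector"
  assumes "z 0 = 0" and b: "\<And>k. k \<le> K \<Longrightarrow> norm (b k) \<le> \<beta>" and "0 \<le> a"
    and r: "\<And>k. k < K \<Longrightarrow> 0 \<le> r k"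
    and step: "\<And>k. k < K \<Longrightarrow> norm (z (Suc k) - z k - (b (Suc k) - b k)) \<le> a * (norm (z k) + norm (z (k - 1))) + r k"
  shows "norm (z K) \<le> \<beta> + exp (2 * a * real K) * (\<beta> + (\<Sum>k<K. r k) + 2 * a * real K * \<beta>)"
proof -
  have \<beta>: "0 \<le> \<beta>" using b[of 0] norm_ge_zero[of "b 0"] by linarith
  let ?x = "\<lambda>k. norm (z k - b k)"
  \<comment> \<open>Replacing \<open>z\<close> by \<open>z - b\<close> on the right of the recursion adds at most \<open>2 a \<beta>\<close> per step.\<close>
  define Q where "Q k = (1 + 2 * a) ^ k * (\<beta> + (\<Sum>j<k. r j + 2 * a * \<beta>))" for k
  have Qmono: "Q k \<le> Q (Suc k)" if "k < K" for k
    unfolding Q_def using r \<open>0 \<le> a\<close> \<beta> that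
    by (intro mult_mono add_mono order_refl power_increasing) (auto intro!: sum_nonneg add_nonneg_nonneg)
  have nz: "norm (z k) \<le> ?x k + \<beta>" if "k \<le> K" for k
    using norm_triangle_ineq[of "z k - b k" "b k"] b[OF that] by simp
  have x: "k \<le> K \<Longrightarrow> ?x k \<le> Q k \<and> ?x (k - 1) \<le> Q k" for k
  proof (induction k)
    case 0
    then show ?case using b[of 0] \<open>z 0 = 0\<close> by (simp add: Q_def)
  next
    case (Suc k)
    then have k: "k < K" and IH: "?x k \<le> Q k" "?x (k - 1) \<le> Q k" by auto
    have "?x (Suc k) \<le> ?x k + norm (z (Suc k) - z k - (b (Suc k) - b k))"
      using norm_triangle_ineq[of "z k - b k" "z (Suc k) - z k - (b (Suc k) - b k)"]
      by (simp add: algebra_simps)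
    also have "\<dots> \<le> ?x k + (a * ((?x k + \<beta>) + (?x (k - 1) + \<beta>)) + r k)"
      using k nz[of k] nz[of "k - 1"] \<open>0 \<le> a\<close>
      by (intro add_left_mono order_trans[OF step] add_right_mono mult_left_mono add_mono) auto
    also have "\<dots> \<le> Q k + (a * ((Q k + \<beta>) + (Q k + \<beta>)) + r k)"
      using IH \<open>0 \<le> a\<close> by (intro add_mono mult_left_mono order_refl) auto
    also have "\<dots> = (1 + 2 * a) * Q k + 1 * (r k + 2 * a * \<beta>)"
      by (simp add: algebra_simps)
    also have "\<dots> \<le> (1 + 2 * a) * Q k + (1 + 2 * a) ^ Suc k * (r k + 2 * a * \<beta>)"
      using \<open>0 \<le> a\<close> r[OF k] \<beta> by (intro add_left_mono mult_right_mono one_le_power) auto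
    also have "\<dots> = Q (Suc k)"
      by (simp add: Q_def algebra_simps)
    finally show ?case using IH(1) Qmono[OF k] by auto
  qed
  have "(1 + 2 * a) ^ K \<le> exp (2 * a) ^ K"
    using \<open>0 \<le> a\<close> by (intro power_mono) (auto simp: exp_ge_add_one_self)
  also have "\<dots> = exp (2 * a * real K)"
    by (metis exp_of_nat_mult mult.commute)
  finally have "Q K \<le> exp (2 * a * real K) * (\<beta> + (\<Sum>j<K. r j + 2 * a * \<beta>))"
    unfolding Q_def using r \<open>0 \<le> a\<close> \<beta>
    by (intro mult_right_mono) (auto intro!: add_nonneg_nonneg sum_nonneg)
  then show ?thesis
    using x[of K] nz[of K] by (simp add: sum.distrib algebra_simps)
qed

lemma sum_central_difference:
  fixes F :: "nat \<Rightarrow> 'a::ab_group_add"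
  shows "(\<Sum>k<n. F (Suc k) - F (k - 1)) = F n + F (n - 1) - (F 0 + F 0)"
  by (induction n) auto

section \<open>One step of the method\<close>

text \<open>
  The numbers \<open>c\<close>, \<open>B\<close> and \<open>M\<close> are parameters: every constant below is an explicit expression in
  them and in \<open>T - t0\<close>, so choosing them independently of the frequencies makes all estimates
  uniform.
\<close>

locale kg_problem =
  fixes G L :: "complex^'x^'x" and m :: "real \<Rightarrow> complex^'x" and t0 T :: real
    and u v :: "complex^'x" and \<psi> \<psi>1 \<psi>2 \<psi>3 :: "real \<Rightarrow> complex^'x"
    and c B M :: real
  assumes less: "t0 < T"
    and G_inv: "matrix_inv G ** G = mat 1"
    and GG: "G ** G = - L"
    and c_nonneg: "0 \<le> c" and B_nonneg: "0 \<le> B"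
    and cos_id: "\<And>t x. t \<in> {0..T - t0} \<Longrightarrow> norm (mat_cos (t *\<^sub>R G) *v x - x) \<le> c * t * norm x"
    and Ginv_sin: "\<And>t x. t \<in> {0..T - t0} \<Longrightarrow>
      norm ((matrix_inv G ** mat_sin (t *\<^sub>R G)) *v x) \<le> c * t * norm x"
    and G_sin: "\<And>t x. t \<in> {0..T - t0} \<Longrightarrow>
      norm ((G ** mat_sin (t *\<^sub>R G)) *v x) \<le> c * t * norm x"
    and L_bound: "\<And>x. norm (L *v x) \<le> c * norm x"
    and m_cont: "continuous_on {t0..T} m"
    and m_bound: "\<And>t. t \<in> {t0..T} \<Longrightarrow> norm (m t) \<le> B"
    and sol: "KG_solution L m t0 T u v \<psi> \<psi>1 \<psi>2 \<psi>3"
    and \<psi>_bound: "\<And>t. t \<in> {t0..T} \<Longrightarrow> norm (\<psi> t) \<le> M"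
    and \<psi>1_bound: "\<And>t. t \<in> {t0..T} \<Longrightarrow> norm (\<psi>1 t) \<le> M"
    and \<psi>2_bound: "\<And>t. t \<in> {t0..T} \<Longrightarrow> norm (\<psi>2 t) \<le> M"
begin

abbreviation "step \<equiv> Xi3_step G m"
abbreviation "cosG t \<equiv> mat_cos (t *\<^sub>R G)"
abbreviation "sinG t \<equiv> mat_sin (t *\<^sub>R G)"

lemma M_nonneg: "0 \<le> M"
  using \<psi>_bound[of t0] less norm_ge_zero[of "\<psi> t0"] by (meson atLeastAtMost_iff less_imp_le order_refl order_trans)

lemma \<psi>_deriv: "t \<in> {t0..T} \<Longrightarrow> (\<psi> has_vector_derivative \<psi>1 t) (at t within {t0..T})"
  and \<psi>1_deriv: "t \<in> {t0..T} \<Longrightarrow> (\<psi>1 has_vector_derivative \<psi>2 t) (at t within {t0..T})"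
  and \<psi>2_deriv: "t \<in> {t0..T} \<Longrightarrow> (\<psi>2 has_vector_derivative \<psi>3 t) (at t within {t0..T})"
  and KG: "t \<in> {t0..T} \<Longrightarrow> \<psi>2 t = L *v \<psi> t + m t * \<psi> t"
  and initial: "\<psi> t0 = u" "\<psi>1 t0 = v"
  and \<psi>3_integrable: "\<psi>3 absolutely_integrable_on {t0..T}"
  using sol unfolding KG_solution_def by blast+

lemma \<psi>_cont: "continuous_on {t0..T} \<psi>"
  by (rule continuous_on_vector_derivative) (rule \<psi>_deriv)

lemma shift_cont:
  assumes "continuous_on {t0..T} f" "t0 \<le> s" "s + h \<le> T"
  shows "continuous_on {0..h} (\<lambda>\<tau>. f (s + \<tau>))"
  by (rule continuous_on_compose2[OF assms(1)]) (use assms in \<open>auto intro!: continuous_intros\<close>)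

lemmas mv_cont = bounded_bilinear.continuous_on[OF bounded_bilinear_matrix_vector_mult]
lemmas tm_cont = bounded_bilinear.continuous_on[OF bounded_bilinear_vec_times]

lemma cosG_cont: "continuous_on {0..h} (\<lambda>\<tau>. cosG (h - \<tau>))"
  by (rule continuous_on_compose2[OF continuous_on_mat_cos[of UNIV]]) (auto intro!: continuous_intros)

lemma sinG_cont: "continuous_on {0..h} (\<lambda>\<tau>. sinG (h - \<tau>))"
  by (rule continuous_on_compose2[OF continuous_on_mat_sin[of UNIV]]) (auto intro!: continuous_intros)

lemma step_integrable:
  assumes "continuous_on {0..h} P" "t0 \<le> s" "s + h \<le> T"
  shows "(\<lambda>\<tau>. m (s + \<tau>) * P \<tau>) integrable_on {0..h}"
    "(\<lambda>\<tau>. (matrix_inv G ** sinG (h - \<tau>)) *v (m (s + \<tau>) * P \<tau>)) integrable_on {0..h}"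
    "(\<lambda>\<tau>. cosG (h - \<tau>) *v (m (s + \<tau>) * P \<tau>)) integrable_on {0..h}"
  by (intro integrable_continuous_interval mv_cont tm_cont continuous_on_matrix_mult continuous_on_const
      cosG_cont sinG_cont shift_cont[OF m_cont] assms)+

lemma step_diff:
  assumes P: "continuous_on {0..h} P" and Q: "continuous_on {0..h} Q" and s: "t0 \<le> s" "s + h \<le> T"
  shows "step h s P z - step h s Q w = step h s (\<lambda>\<tau>. P \<tau> - Q \<tau>) (z - w)"
proof -
  have *: "A *v (m (s + \<tau>) * (P \<tau> - Q \<tau>)) = A *v (m (s + \<tau>) * P \<tau>) - A *v (m (s + \<tau>) * Q \<tau>)"
    for A :: "complex^'x^'x" and \<tau>
    by (simp add: right_diff_distrib matrix_vector_mult_diff_distrib)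
  show ?thesis
    unfolding Xi3_step_def * integral_diff[OF step_integrable(2)[OF P s] step_integrable(2)[OF Q s]]
      integral_diff[OF step_integrable(3)[OF P s] step_integrable(3)[OF Q s]]
    by (cases z; cases w) (simp add: matrix_vector_mult_diff_distrib)
qed

lemma integral_norm_le:
  fixes f :: "real \<Rightarrow> complex^'x"
  assumes "f integrable_on {0..h}" "0 \<le> h" "\<And>\<tau>. \<tau> \<in> {0..h} \<Longrightarrow> norm (f \<tau>) \<le> b"
  shows "norm (integral {0..h} f) \<le> h * b"
proof -
  have "norm (integral {0..h} f) \<le> integral {0..h} (\<lambda>\<tau>. b)"
    by (rule integral_norm_bound_integral) (use assms in auto)
  then show ?thesis using assms by simp
qed

lemma times_bound: "norm x \<le> b \<Longrightarrow> norm y \<le> b' \<Longrightarrow> norm (x * y) \<le> b * b'" for x y :: "complex^'x"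
  by (rule order_trans[OF norm_vec_times_le]) (auto intro!: mult_mono order_trans[OF norm_ge_zero])

text \<open>
  A step is the identity up to \<open>O(h)\<close>, and the forcing enters the position with an additional
  factor \<open>h\<close>; only its plain integral in the velocity is of lower order.
\<close>

lemma step_expansion:
  assumes P: "continuous_on {0..h} P" and s: "t0 \<le> s" "s + h \<le> T" and "0 \<le> h"
    and p: "\<And>\<tau>. \<tau> \<in> {0..h} \<Longrightarrow> norm (P \<tau>) \<le> p"
  shows "norm (step h s P z - z - (0, integral {0..h} (\<lambda>\<tau>. m (s + \<tau>) * P \<tau>)))
           \<le> c * h * (4 * norm z + 2 * h * B * p)"
proof -
  obtain a b where z: "z = (a, b)" by (cases z)
  have ab: "norm a \<le> norm z" "norm b \<le> norm z"
    using norm_fst_le[of a b] norm_snd_le[of b a] z by auto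
  have h: "h \<in> {0..T - t0}" using assms by auto
  have p0: "0 \<le> p" using p[of 0] norm_ge_zero[of "P 0"] \<open>0 \<le> h\<close> by (meson atLeastAtMost_iff order_refl order_trans)
  have mP: "norm (m (s + \<tau>) * P \<tau>) \<le> B * p" if "\<tau> \<in> {0..h}" for \<tau>
    using that s by (intro times_bound m_bound p) auto
  have up: "c * (h - \<tau>) * norm (m (s + \<tau>) * P \<tau>) \<le> c * h * (B * p)" if "\<tau> \<in> {0..h}" for \<tau>
    using that mP c_nonneg B_nonneg p0 by (intro mult_mono) auto
  have I1: "norm (integral {0..h} (\<lambda>\<tau>. (matrix_inv G ** sinG (h - \<tau>)) *v (m (s + \<tau>) * P \<tau>))) \<le> h * (c * h * (B * p))"
    by (rule integral_norm_le[OF step_integrable(2)[OF P s] \<open>0 \<le> h\<close>])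
       (rule order_trans[OF Ginv_sin up]; use h in auto)
  have "norm (integral {0..h} (\<lambda>\<tau>. cosG (h - \<tau>) *v (m (s + \<tau>) * P \<tau>) - m (s + \<tau>) * P \<tau>)) \<le> h * (c * h * (B * p))"
    by (rule integral_norm_le[OF integrable_diff[OF step_integrable(3)[OF P s] step_integrable(1)[OF P s]] \<open>0 \<le> h\<close>])
       (rule order_trans[OF cos_id up]; use h in auto)
  then have I2: "norm (integral {0..h} (\<lambda>\<tau>. cosG (h - \<tau>) *v (m (s + \<tau>) * P \<tau>)) - integral {0..h} (\<lambda>\<tau>. m (s + \<tau>) * P \<tau>)) \<le> h * (c * h * (B * p))"
    by (simp add: integral_diff step_integrable[OF P s])
  have lin: "norm x \<le> norm z \<Longrightarrow> c * h * norm x \<le> c * h * norm z" for x :: "complex^'x"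
    using c_nonneg \<open>0 \<le> h\<close> by (intro mult_left_mono) auto
  define I J K where "I = integral {0..h} (\<lambda>\<tau>. (matrix_inv G ** sinG (h - \<tau>)) *v (m (s + \<tau>) * P \<tau>))"
    and "J = integral {0..h} (\<lambda>\<tau>. cosG (h - \<tau>) *v (m (s + \<tau>) * P \<tau>))"
    and "K = integral {0..h} (\<lambda>\<tau>. m (s + \<tau>) * P \<tau>)"
  have "step h s P z - z - (0, K) = ((cosG h *v a - a) + (matrix_inv G ** sinG h) *v b + I,
      - ((G ** sinG h) *v a) + (cosG h *v b - b) + (J - K))"
    by (simp add: Xi3_step_def z I_def J_def)
  also have "norm \<dots> \<le> norm ((cosG h *v a - a) + (matrix_inv G ** sinG h) *v b + I)
      + norm (- ((G ** sinG h) *v a) + (cosG h *v b - b) + (J - K))"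
    by (rule norm_Pair_le)
  also have "\<dots> \<le> (c * h * norm z + c * h * norm z + h * (c * h * (B * p)))
      + (c * h * norm z + c * h * norm z + h * (c * h * (B * p)))"
    using order_trans[OF cos_id[OF h] lin[OF ab(1)]] order_trans[OF cos_id[OF h] lin[OF ab(2)]]
      order_trans[OF Ginv_sin[OF h] lin[OF ab(2)]] order_trans[OF G_sin[OF h] lin[OF ab(1)]] I1 I2
    by (intro add_mono norm_triangle_le) (auto simp: I_def J_def K_def)
  also have "\<dots> = c * h * (4 * norm z + 2 * h * B * p)"
    by (simp add: algebra_simps)
  finally show ?thesis by (simp add: K_def)
qed

text \<open>
  Both integrands are derivatives, with respect to \<open>\<tau>\<close>, of the exact solution at time \<open>s + \<tau>\<close>
  propagated freely over the remaining time \<open>h - \<tau>\<close>.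
\<close>

lemma step_exact:
  assumes s: "t0 \<le> s" "s + h \<le> T" and "0 \<le> h"
  shows "step h s (\<lambda>\<tau>. \<psi> (s + \<tau>)) (\<psi> s, \<psi>1 s) = (\<psi> (s + h), \<psi>1 (s + h))"
proof -
  have refl_deriv: "((\<lambda>\<tau>. F (h - \<tau>)) has_vector_derivative - D) (at \<tau> within {0..h})"
    if "(F has_vector_derivative D) (at (h - \<tau>))" for F :: "real \<Rightarrow> complex^'x^'x" and D \<tau>
  proof -
    have "((\<lambda>\<tau>. h - \<tau>) has_vector_derivative -1) (at \<tau> within {0..h})"
      by (auto intro!: derivative_eq_intros simp flip: has_real_derivative_iff_has_vector_derivative)
    from vector_diff_chain_within[OF this, of F D] that show ?thesis
      by (simp add: o_def has_vector_derivative_at_within)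
  qed
  let ?S = "\<lambda>t. matrix_inv G ** sinG t"
  have dC: "((\<lambda>\<tau>. cosG (h - \<tau>)) has_vector_derivative G ** sinG (h - \<tau>)) (at \<tau> within {0..h})" for \<tau>
    using refl_deriv[OF mat_cos_has_vector_derivative[of G "h - \<tau>"]] by simp
  have dS: "((\<lambda>\<tau>. ?S (h - \<tau>)) has_vector_derivative - cosG (h - \<tau>)) (at \<tau> within {0..h})" for \<tau>
    using refl_deriv[OF has_vector_derivative_matrix_mult[OF mat_sin_has_vector_derivative[of G "h - \<tau>"], of "matrix_inv G"]]
    by (simp add: matrix_mul_assoc G_inv)
  have dGS: "((\<lambda>\<tau>. G ** sinG (h - \<tau>)) has_vector_derivative - (G ** (G ** cosG (h - \<tau>)))) (at \<tau> within {0..h})" for \<tau>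
    using refl_deriv[OF has_vector_derivative_matrix_mult[OF mat_sin_has_vector_derivative[of G "h - \<tau>"], of G]] .
  have d0: "((\<lambda>\<tau>. \<psi> (s + \<tau>)) has_vector_derivative \<psi>1 (s + \<tau>)) (at \<tau> within {0..h})"
    and d1: "((\<lambda>\<tau>. \<psi>1 (s + \<tau>)) has_vector_derivative \<psi>2 (s + \<tau>)) (at \<tau> within {0..h})"
    if "\<tau> \<in> {0..h}" for \<tau>
    using that s by (auto intro!: has_vector_derivative_shift[where A="{t0..T}"] \<psi>_deriv \<psi>1_deriv)
  note mv = bounded_bilinear.has_vector_derivative[OF bounded_bilinear_matrix_vector_mult]
  have Lv: "L *v x = - (G *v (G *v x))" for x
  proof -
    have "G *v (G *v x) = (- L) *v x" by (simp add: matrix_vector_mul_assoc GG)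
    then show ?thesis by (simp add: bounded_bilinear.minus_left[OF bounded_bilinear_matrix_vector_mult])
  qed
  have mva: "(X ** Y) *v x = X *v (Y *v x)" for X Y :: "complex^'x^'x" and x
    by (simp add: matrix_vector_mul_assoc)
  have GS: "sinG t *v (G *v x) = G *v (sinG t *v x)" for t x
    by (simp add: matrix_vector_mul_assoc mat_sin_commute)
  have GC: "cosG t *v (G *v x) = G *v (cosG t *v x)" for t x
    by (simp add: matrix_vector_mul_assoc mat_cos_commute)
  have Gi: "matrix_inv G *v (G *v x) = x" for x
    by (simp add: matrix_vector_mul_assoc G_inv)
  have neg: "A *v (- x) = - (A *v x)" "(- A) *v x = - (A *v x)" for A :: "complex^'x^'x" and x
    by (simp_all add: bounded_bilinear.minus_left[OF bounded_bilinear_matrix_vector_mult]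
        bounded_bilinear.minus_right[OF bounded_bilinear_matrix_vector_mult])
  have "((\<lambda>\<tau>. ?S (h - \<tau>) *v (m (s + \<tau>) * \<psi> (s + \<tau>))) has_integral
      (cosG (h - h) *v \<psi> (s + h) + ?S (h - h) *v \<psi>1 (s + h)) - (cosG (h - 0) *v \<psi> (s + 0) + ?S (h - 0) *v \<psi>1 (s + 0))) {0..h}"
  proof (rule fundamental_theorem_of_calculus[OF \<open>0 \<le> h\<close>])
    fix \<tau> assume \<tau>: "\<tau> \<in> {0..h}"
    have "\<psi>2 (s + \<tau>) = - (G *v (G *v \<psi> (s + \<tau>))) + m (s + \<tau>) * \<psi> (s + \<tau>)"
      using KG[of "s + \<tau>"] \<tau> s by (simp add: Lv)
    then show "((\<lambda>\<tau>. cosG (h - \<tau>) *v \<psi> (s + \<tau>) + ?S (h - \<tau>) *v \<psi>1 (s + \<tau>)) has_vector_derivative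
        ?S (h - \<tau>) *v (m (s + \<tau>) * \<psi> (s + \<tau>))) (at \<tau> within {0..h})"
      by (intro has_vector_derivative_eq_rhs[OF has_vector_derivative_add[OF mv[OF dC d0[OF \<tau>]] mv[OF dS d1[OF \<tau>]]]])
         (simp add: mva matrix_vector_right_distrib matrix_vector_mult_diff_distrib neg GS Gi)
  qed
  then have 1: "integral {0..h} (\<lambda>\<tau>. ?S (h - \<tau>) *v (m (s + \<tau>) * \<psi> (s + \<tau>)))
      = \<psi> (s + h) - (cosG h *v \<psi> s + ?S h *v \<psi>1 s)"
    by (simp add: integral_unique mat_cos_0[simplified] mat_sin_0[simplified]
        bounded_bilinear.zero_right[OF bounded_bilinear_matrix_matrix_mult])
  have "((\<lambda>\<tau>. cosG (h - \<tau>) *v (m (s + \<tau>) * \<psi> (s + \<tau>))) has_integral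
      (- ((G ** sinG (h - h)) *v \<psi> (s + h)) + cosG (h - h) *v \<psi>1 (s + h)) - (- ((G ** sinG (h - 0)) *v \<psi> (s + 0)) + cosG (h - 0) *v \<psi>1 (s + 0))) {0..h}"
  proof (rule fundamental_theorem_of_calculus[OF \<open>0 \<le> h\<close>])
    fix \<tau> assume \<tau>: "\<tau> \<in> {0..h}"
    have "\<psi>2 (s + \<tau>) = - (G *v (G *v \<psi> (s + \<tau>))) + m (s + \<tau>) * \<psi> (s + \<tau>)"
      using KG[of "s + \<tau>"] \<tau> s by (simp add: Lv)
    then show "((\<lambda>\<tau>. - ((G ** sinG (h - \<tau>)) *v \<psi> (s + \<tau>)) + cosG (h - \<tau>) *v \<psi>1 (s + \<tau>)) has_vector_derivative
        cosG (h - \<tau>) *v (m (s + \<tau>) * \<psi> (s + \<tau>))) (at \<tau> within {0..h})"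
      by (intro has_vector_derivative_eq_rhs[OF has_vector_derivative_add[OF has_vector_derivative_minus[OF mv[OF dGS d0[OF \<tau>]]] mv[OF dC d1[OF \<tau>]]]])
         (simp add: mva matrix_vector_right_distrib matrix_vector_mult_diff_distrib neg GC)
  qed
  then have 2: "integral {0..h} (\<lambda>\<tau>. cosG (h - \<tau>) *v (m (s + \<tau>) * \<psi> (s + \<tau>)))
      = \<psi>1 (s + h) - (- ((G ** sinG h) *v \<psi> s) + cosG h *v \<psi>1 s)"
    by (simp add: integral_unique mat_cos_0[simplified] mat_sin_0[simplified]
        bounded_bilinear.zero_right[OF bounded_bilinear_matrix_matrix_mult])
  show ?thesis
    by (simp add: Xi3_step_def 1 2)
qed

end

section \<open>The error recursion on a grid\<close>

locale kg_grid = kg_problem G L m t0 T u v \<psi> \<psi>1 \<psi>2 \<psi>3 c B M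
  for G L :: "complex^'x^'x" and m t0 T u v \<psi> \<psi>1 \<psi>2 \<psi>3 c B M +
  fixes K :: nat and h :: real
  assumes K: "1 \<le> K" and h: "h = (T - t0) / real K"
begin

definition tm :: "nat \<Rightarrow> real" where "tm k = t0 + real k * h"

definition err :: "nat \<Rightarrow> (complex^'x) \<times> (complex^'x)" where
  "err k = (\<psi> (tm k), \<psi>1 (tm k)) - Xi3 L G m t0 h u v k"

definition defect :: "nat \<Rightarrow> real \<Rightarrow> complex^'x" where
  "defect k \<tau> = (if k = 0 then \<psi> (t0 + \<tau>) - (u + \<tau> *\<^sub>R v + (\<tau>\<^sup>2 / 2) *\<^sub>R (L *v u + m t0 * u))
     else \<psi> (tm k + \<tau>) - (\<psi> (tm k) + \<tau> *\<^sub>R \<psi>1 (tm k)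
       + (\<tau>\<^sup>2 / (2 * h)) *\<^sub>R (\<psi>1 (tm k) - \<psi>1 (tm (k - 1)))))"

text \<open>
  The leading part of the local error; by \<open>step_expansion\<close> what it omits is smaller by a factor \<open>h\<close>.
\<close>

definition local_err :: "nat \<Rightarrow> (complex^'x) \<times> (complex^'x)" where
  "local_err k = (0, integral {0..h} (\<lambda>\<tau>. m (tm k + \<tau>) * defect k \<tau>))"

text \<open>
  The Lipschitz constant of the scheme per unit time: the first term comes from the propagators,
  the second from the forcing, which also involves the velocity of the preceding step.
\<close>

definition \<Lambda> :: real where
  "\<Lambda> = 4 * c + (2 * c * (T - t0) + 1) * B * (1 + 2 * (T - t0))"

lemma h_pos: "0 < h" using less K h by simp

lemma hK: "h * real K = T - t0" using K h by simp

lemma h_le: "h \<le> T - t0"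
  using mult_left_mono[of 1 "real K" h] K h_pos hK by simp

lemma tm_0 [simp]: "tm 0 = t0" and tm_K: "tm K = T"
  using hK by (simp_all add: tm_def mult.commute)

lemma tm_Suc: "tm (Suc k) = tm k + h" by (simp add: tm_def algebra_simps)

lemma tm_mono: "j \<le> k \<Longrightarrow> tm j \<le> tm k"
  using h_pos by (simp add: tm_def)

lemma tm_range: "k \<le> K \<Longrightarrow> t0 \<le> tm k \<and> tm k \<le> T"
  using tm_mono[of 0 k] tm_mono[of k K] tm_K by simp

lemma tm_pred: "1 \<le> k \<Longrightarrow> tm (k - 1) = tm k - h"
  using tm_Suc[of "k - 1"] by simp

lemma window: "k < K \<Longrightarrow> {tm (k - 1)..tm (Suc k)} \<subseteq> {t0..T}"
  using tm_range[of "k - 1"] tm_range[of "Suc k"] by auto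

lemma \<Lambda>_nonneg: "0 \<le> \<Lambda>"
  using c_nonneg B_nonneg less by (simp add: \<Lambda>_def)

lemma defect_cont:
  assumes "k < K" shows "continuous_on {0..h} (defect k)"
proof -
  have "continuous_on {0..h} (\<lambda>\<tau>. \<psi> (tm k + \<tau>))"
    using tm_range[of k] tm_range[of "Suc k"] assms by (intro shift_cont \<psi>_cont) (auto simp: tm_Suc)
  then show ?thesis
    using h_pos by (cases "k = 0") (auto simp: defect_def intro!: continuous_intros)
qed

lemma err_0: "err 0 = 0" by (simp add: err_def initial)

lemma err_Suc:
  assumes "k < K"
  shows "err (Suc k) = step h (tm k) (\<lambda>\<tau>. fst (err k) + \<tau> *\<^sub>R snd (err k)
     + (\<tau>\<^sup>2 / (2 * h)) *\<^sub>R (snd (err k) - snd (err (k - 1))) + defect k \<tau>) (err k)"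
proof -
  have s: "t0 \<le> tm k" "tm k + h \<le> T" using tm_range[of k] tm_range[of "Suc k"] assms by (auto simp: tm_Suc)
  have exact: "(\<psi> (tm (Suc k)), \<psi>1 (tm (Suc k))) = step h (tm k) (\<lambda>\<tau>. \<psi> (tm k + \<tau>)) (\<psi> (tm k), \<psi>1 (tm k))"
    using step_exact[OF s] h_pos by (simp add: tm_Suc)
  have \<psi>c: "continuous_on {0..h} (\<lambda>\<tau>. \<psi> (tm k + \<tau>))" by (intro shift_cont \<psi>_cont s)
  show ?thesis
  proof (cases k)
    case 0
    have d: "defect 0 = (\<lambda>\<tau>. \<psi> (t0 + \<tau>) - (u + \<tau> *\<^sub>R v + (\<tau>\<^sup>2 / 2) *\<^sub>R (L *v u + m t0 * u)))"
      by (simp add: defect_def fun_eq_iff)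
    show ?thesis
      unfolding err_def[of "Suc k"] exact
      by (simp add: 0 initial err_0 tm_0 d)
         (subst step_diff; use s \<psi>c h_pos in \<open>auto simp: 0 initial intro!: continuous_intros\<close>)
  next
    case (Suc j)
    define X where "X i = Xi3 L G m t0 h u v i" for i
    define Q where "Q \<tau> = fst (X k) + \<tau> *\<^sub>R snd (X k)
        + (\<tau>\<^sup>2 / (2 * h)) *\<^sub>R (snd (X k) - snd (X j))" for \<tau>
    have Qc: "continuous_on {0..h} Q"
      unfolding Q_def using h_pos by (auto intro!: continuous_intros)
    have "X (Suc k) = step h (tm k) Q (X k)"
      by (simp add: X_def Q_def[abs_def] Suc tm_def Let_def split_beta)
    then have "err (Suc k) = step h (tm k) (\<lambda>\<tau>. \<psi> (tm k + \<tau>) - Q \<tau>) (err k)"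
      unfolding err_def exact X_def[symmetric] by (simp add: step_diff[OF \<psi>c Qc s])
    also have "(\<lambda>\<tau>. \<psi> (tm k + \<tau>) - Q \<tau>) = (\<lambda>\<tau>. fst (err k) + \<tau> *\<^sub>R snd (err k)
     + (\<tau>\<^sup>2 / (2 * h)) *\<^sub>R (snd (err k) - snd (err (k - 1))) + defect k \<tau>)"
      by (simp add: fun_eq_iff err_def X_def Q_def Suc defect_def algebra_simps)
    finally show ?thesis .
  qed
qed

text \<open>
  The quadratic built from the errors is linear in them; the division by \<open>h\<close> in its last coefficient
  is harmless because \<open>\<tau>\<^sup>2/(2h) \<le> h/2\<close>.
\<close>

lemma err_recursion:
  assumes k: "k < K" and p: "\<And>\<tau>. \<tau> \<in> {0..h} \<Longrightarrow> norm (defect k \<tau>) \<le> p"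
  shows "norm (err (Suc k) - err k - local_err k)
    \<le> \<Lambda> * h * (norm (err k) + norm (err (k - 1))) + 2 * c * B * h\<^sup>2 * p"
proof -
  let ?H = "T - t0"
  define e e' where "e = err k" and "e' = err (k - 1)"
  define lin where "lin \<tau> = fst e + \<tau> *\<^sub>R snd e + (\<tau>\<^sup>2 / (2 * h)) *\<^sub>R (snd e - snd e')" for \<tau>
  define l where "l = (1 + 2 * ?H) * (norm e + norm e')"
  have s: "t0 \<le> tm k" "tm k + h \<le> T" using tm_range[of k] tm_range[of "Suc k"] k by (auto simp: tm_Suc)
  have linc: "continuous_on {0..h} lin"
    unfolding lin_def using h_pos by (auto intro!: continuous_intros)
  have lin: "norm (lin \<tau>) \<le> l" if \<tau>: "\<tau> \<in> {0..h}" for \<tau>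
  proof -
    have n: "norm (fst e) \<le> norm e" "norm (snd e) \<le> norm e" "norm (snd e') \<le> norm e'"
      using norm_fst_le[of "fst e" "snd e"] norm_snd_le[of "snd e" "fst e"] norm_snd_le[of "snd e'" "fst e'"] by auto
    have "\<tau>\<^sup>2 / (2 * h) \<le> h\<^sup>2 / (2 * h)"
      using \<tau> h_pos by (intro divide_right_mono power_mono) auto
    then have q: "\<tau>\<^sup>2 / (2 * h) \<le> ?H" using h_pos h_le by (simp add: power2_eq_square)
    have q0: "0 \<le> \<tau>\<^sup>2 / (2 * h)" using h_pos by simp
    have "norm (lin \<tau>) \<le> norm (fst e) + norm (\<tau> *\<^sub>R snd e) + norm ((\<tau>\<^sup>2 / (2 * h)) *\<^sub>R (snd e - snd e'))"
      unfolding lin_def by (intro norm_triangle_le add_mono order_refl)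
    also have "\<dots> \<le> norm e + ?H * norm e + ?H * (norm e + norm e')"
    proof (intro add_mono n)
      show "norm (\<tau> *\<^sub>R snd e) \<le> ?H * norm e"
        unfolding norm_scaleR using \<tau> h_le n by (intro mult_mono) auto
      have "norm (snd e - snd e') \<le> norm e + norm e'"
        using norm_triangle_ineq4[of "snd e" "snd e'"] n by linarith
      then show "norm ((\<tau>\<^sup>2 / (2 * h)) *\<^sub>R (snd e - snd e')) \<le> ?H * (norm e + norm e')"
        unfolding norm_scaleR using q q0 less by (intro mult_mono) auto
    qed
    also have "\<dots> \<le> l"
      using mult_nonneg_nonneg[of ?H "norm e'"] norm_ge_zero[of e'] less by (simp add: l_def algebra_simps del: norm_ge_zero)
    finally show ?thesis .
  qed
  define I where "I = integral {0..h} (\<lambda>\<tau>. m (tm k + \<tau>) * lin \<tau>)"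
  have I: "norm I \<le> h * (B * l)"
    unfolding I_def using s h_pos
    by (intro integral_norm_le step_integrable linc times_bound m_bound lin) auto
  have split: "(0, integral {0..h} (\<lambda>\<tau>. m (tm k + \<tau>) * (lin \<tau> + defect k \<tau>))) = (0, I) + local_err k"
    by (simp add: I_def local_err_def distrib_left integral_add step_integrable[OF linc s]
        step_integrable[OF defect_cont[OF k] s])
  have "norm (err (Suc k) - e - ((0, I) + local_err k)) \<le> c * h * (4 * norm e + 2 * h * B * (l + p))"
    unfolding split[symmetric] err_Suc[OF k] e_def[symmetric] e'_def[symmetric] lin_def[symmetric]
    using h_pos by (intro step_expansion s continuous_on_add linc defect_cont k norm_triangle_le add_mono lin p) auto
  moreover have "norm (0 :: complex^'x, I) = norm I"
    by (simp add: norm_Pair)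
  ultimately have "norm (err (Suc k) - e - local_err k) \<le> c * h * (4 * norm e + 2 * h * B * (l + p)) + h * (B * l)"
    using I norm_triangle_ineq[of "err (Suc k) - e - ((0, I) + local_err k)" "(0, I)"]
    by (simp add: algebra_simps)
  also have "\<dots> = h * (4 * c * norm e + (2 * c * h + 1) * B * l) + 2 * c * B * h\<^sup>2 * p"
    by (simp add: algebra_simps power2_eq_square)
  also have "h * (4 * c * norm e + (2 * c * h + 1) * B * l) \<le> h * (4 * c * (norm e + norm e') + (2 * c * ?H + 1) * B * l)"
    using h_pos h_le c_nonneg B_nonneg less
    by (intro mult_left_mono add_mono mult_right_mono) (auto simp: l_def intro: mult_left_mono)
  also have "\<dots> = \<Lambda> * h * (norm e + norm e')"
    by (simp add: \<Lambda>_def l_def algebra_simps)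
  finally show ?thesis by (simp add: e_def e'_def)
qed

text \<open>
  The correction \<open>b\<close> is free, and each of the bounds below comes from one choice of it: \<open>0\<close> for those
  valid for every step size, and the leading part of the accumulated error for the sharp one.
\<close>

lemma global_error:
  assumes b: "\<And>k. k \<le> K \<Longrightarrow> norm (b k) \<le> \<beta>"
    and r: "\<And>k. k < K \<Longrightarrow> 0 \<le> r k"
    and p: "\<And>k \<tau>. k < K \<Longrightarrow> \<tau> \<in> {0..h} \<Longrightarrow> norm (defect k \<tau>) \<le> p k"
    and lr: "\<And>k. k < K \<Longrightarrow> norm (local_err k - (b (Suc k) - b k)) + 2 * c * B * h\<^sup>2 * p k \<le> r k"
  shows "norm (err K) \<le> \<beta> + exp (2 * \<Lambda> * (T - t0)) * (\<beta> + (\<Sum>k<K. r k) + 2 * \<Lambda> * (T - t0) * \<beta>)"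
proof -
  have "norm (err K) \<le> \<beta> + exp (2 * (\<Lambda> * h) * real K) * (\<beta> + (\<Sum>k<K. r k) + 2 * (\<Lambda> * h) * real K * \<beta>)"
  proof (rule two_step_Gronwall[where b=b])
    fix k assume k: "k < K"
    have "norm (err (Suc k) - err k - (b (Suc k) - b k))
        \<le> norm (err (Suc k) - err k - local_err k) + norm (local_err k - (b (Suc k) - b k))"
      using norm_triangle_ineq[of "err (Suc k) - err k - local_err k" "local_err k - (b (Suc k) - b k)"]
      by (simp add: algebra_simps)
    then show "norm (err (Suc k) - err k - (b (Suc k) - b k)) \<le> \<Lambda> * h * (norm (err k) + norm (err (k - 1))) + r k"
      using err_recursion[OF k p[OF k]] lr[OF k] by linarith
  qed (use b r err_0 \<Lambda>_nonneg h_pos in auto)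
  moreover have "2 * (\<Lambda> * h) * real K = 2 * \<Lambda> * (T - t0)"
    using hK by (simp add: mult_ac)
  ultimately show ?thesis by simp
qed

lemma \<psi>2_KG_0: "\<psi>2 t0 = L *v u + m t0 * u"
  using KG[of t0] initial less by simp

lemma defect_expansion:
  assumes k: "1 \<le> k" "k < K" and \<tau>: "\<tau> \<in> {0..h}"
    and f2: "\<And>x y. x \<in> {tm (k - 1)..tm (Suc k)} \<Longrightarrow> y \<in> {tm (k - 1)..tm (Suc k)} \<Longrightarrow>
      norm (\<psi>2 x - \<psi>2 y - ((x - y) / h) *\<^sub>R \<delta>) \<le> \<eta>"
  shows "norm (defect k \<tau> - (\<tau>^3 / (6 * h) + \<tau>\<^sup>2 / 4) *\<^sub>R \<delta>) \<le> \<eta> * h\<^sup>2"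
proof -
  have w: "{tm (k - 1)..tm (Suc k)} = {tm k - h..tm k + h}"
    unfolding tm_pred[OF k(1)] tm_Suc ..
  have sub: "{tm k - h..tm k + h} \<subseteq> {t0..T}" using window[OF k(2)] unfolding w .
  have d: "(\<psi> has_vector_derivative \<psi>1 t) (at t within {tm k - h..tm k + h})"
    "(\<psi>1 has_vector_derivative \<psi>2 t) (at t within {tm k - h..tm k + h})" if "t \<in> {tm k - h..tm k + h}" for t
    using has_vector_derivative_within_subset[OF \<psi>_deriv sub]
      has_vector_derivative_within_subset[OF \<psi>1_deriv sub] sub that by blast+
  have "defect k \<tau> = \<psi> (tm k + \<tau>) - (\<psi> (tm k) + \<tau> *\<^sub>R \<psi>1 (tm k)
      + (\<tau>\<^sup>2 / (2 * h)) *\<^sub>R (\<psi>1 (tm k) - \<psi>1 (tm k - h)))"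
    using k tm_pred[OF k(1)] by (simp add: defect_def)
  then have "norm (defect k \<tau> - (\<tau>^3 / (6 * h) + \<tau>\<^sup>2 / 4) *\<^sub>R \<delta>) \<le> \<eta> * \<tau>\<^sup>2"
    using extrapolation_error[OF h_pos d f2[unfolded w] \<tau>] by simp
  also have "\<dots> \<le> \<eta> * h\<^sup>2"
  proof (intro mult_left_mono power_mono)
    have "tm k \<in> {tm (k - 1)..tm (Suc k)}" using w h_pos by simp
    from f2[OF this this] show "0 \<le> \<eta>" by simp
  qed (use \<tau> in auto)
  finally show ?thesis .
qed

lemma defect_bound:
  assumes k: "k < K" and \<tau>: "\<tau> \<in> {0..h}"
    and f2: "\<And>x y. x \<in> {tm (k - 1)..tm (Suc k)} \<Longrightarrow> y \<in> {tm (k - 1)..tm (Suc k)} \<Longrightarrow>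
      norm (\<psi>2 x - \<psi>2 y) \<le> \<eta>"
  shows "norm (defect k \<tau>) \<le> \<eta> * h\<^sup>2"
proof (cases "k = 0")
  case True
  have w: "{tm (k - 1)..tm (Suc k)} = {t0..t0 + h}"
    using True tm_Suc[of k] by simp
  have sub: "{t0..t0 + h} \<subseteq> {t0..T}" using h_le by auto
  have "norm (defect k \<tau>) \<le> \<eta> * \<tau>\<^sup>2"
  proof -
    have d: "(\<psi> has_vector_derivative \<psi>1 t) (at t within {t0..t0+h})"
      "(\<psi>1 has_vector_derivative \<psi>2 t) (at t within {t0..t0+h})" if "t \<in> {t0..t0+h}" for t
      using has_vector_derivative_within_subset[OF \<psi>_deriv sub]
        has_vector_derivative_within_subset[OF \<psi>1_deriv sub] sub that by blast+
    have e: "norm (\<psi>2 x - \<psi>2 t0) \<le> \<eta>" if "x \<in> {t0..t0+h}" for x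
      using f2[unfolded w, OF that, of t0] h_pos by simp
    have "norm (\<psi> (t0 + \<tau>) - (\<psi> t0 + \<tau> *\<^sub>R \<psi>1 t0 + (\<tau>\<^sup>2 / 2) *\<^sub>R \<psi>2 t0)) \<le> \<eta> * \<tau>\<^sup>2"
      by (rule Taylor_quadratic_error[OF d e \<tau>])
    then show ?thesis using True by (simp add: defect_def initial \<psi>2_KG_0)
  qed
  also have "\<dots> \<le> \<eta> * h\<^sup>2"
  proof (intro mult_left_mono power_mono)
    have "t0 \<in> {tm (k - 1)..tm (Suc k)}" using w h_pos by simp
    from f2[OF this this] show "0 \<le> \<eta>" by simp
  qed (use \<tau> in auto)
  finally show ?thesis .
next
  case False
  with defect_expansion[of k \<tau> 0 \<eta>] assms show ?thesis by simp
qed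

section \<open>Bounds that hold for every step size\<close>

text \<open>
  Gronwall's factor times a bound for the local error per unit of \<open>h\<^sup>3\<close> and of oscillation of \<open>\<psi>''\<close>.
\<close>

definition osc_const :: real where
  "osc_const = exp (2 * \<Lambda> * (T - t0)) * (B + 2 * c * B * (T - t0))"

lemma error_le_sum_oscillation:
  assumes \<eta>: "\<And>k. k < K \<Longrightarrow> 0 \<le> \<eta> k"
    and f2: "\<And>k x y. k < K \<Longrightarrow> x \<in> {tm (k - 1)..tm (Suc k)} \<Longrightarrow> y \<in> {tm (k - 1)..tm (Suc k)} \<Longrightarrow>
      norm (\<psi>2 x - \<psi>2 y) \<le> \<eta> k"
  shows "norm (err K) \<le> osc_const * h^3 * (\<Sum>k<K. \<eta> k)"
proof -
  let ?r = "\<lambda>k. (B + 2 * c * B * (T - t0)) * h^3 * \<eta> k"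
  have "norm (err K) \<le> 0 + exp (2 * \<Lambda> * (T - t0)) * (0 + (\<Sum>k<K. ?r k) + 2 * \<Lambda> * (T - t0) * 0)"
  proof (rule global_error[where b="\<lambda>k. 0" and p="\<lambda>k. \<eta> k * h\<^sup>2"])
    fix k assume k: "k < K"
    show "0 \<le> ?r k" using \<eta>[OF k] B_nonneg c_nonneg less h_pos by simp
    show d: "norm (defect k \<tau>) \<le> \<eta> k * h\<^sup>2" if "\<tau> \<in> {0..h}" for \<tau>
      using that by (intro defect_bound k f2)
    have "norm (local_err k) \<le> h * (B * (\<eta> k * h\<^sup>2))"
      using tm_range[of k] tm_range[of "Suc k"] k h_pos
      unfolding local_err_def norm_Pair norm_zero zero_power2 add_0_left real_sqrt_power[symmetric] real_sqrt_abs abs_norm_cancel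
      by (intro integral_norm_le step_integrable defect_cont times_bound m_bound d) (auto simp: tm_Suc)
    moreover have "2 * c * B * h\<^sup>2 * (\<eta> k * h\<^sup>2) \<le> 2 * c * B * (T - t0) * h^3 * \<eta> k"
    proof -
      have "2 * c * B * h^3 * \<eta> k * h \<le> 2 * c * B * h^3 * \<eta> k * (T - t0)"
        using \<eta>[OF k] B_nonneg c_nonneg h_pos h_le by (intro mult_left_mono) auto
      then show ?thesis by (simp add: power2_eq_square power3_eq_cube mult_ac)
    qed
    ultimately show "norm (local_err k - (0 - 0)) + 2 * c * B * h\<^sup>2 * (\<eta> k * h\<^sup>2) \<le> ?r k"
      by (simp add: algebra_simps power2_eq_square power3_eq_cube)
  qed simp
  also have "\<dots> = osc_const * h^3 * (\<Sum>k<K. \<eta> k)"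
    by (simp add: osc_const_def mult_ac flip: sum_distrib_left sum_distrib_right)
  finally show ?thesis .
qed

text \<open>
  The oscillation of \<open>\<psi>''\<close> is at most \<open>2 M\<close> on each of the \<open>K\<close> steps, and summing costs one power
  of \<open>h\<close>.
\<close>

lemma error_uniform: "norm (err K) \<le> osc_const * (2 * M * (T - t0)) * h\<^sup>2"
proof -
  have "norm (err K) \<le> osc_const * h^3 * (\<Sum>k<K. 2 * M)"
  proof (rule error_le_sum_oscillation)
    fix k x y assume "k < K" "x \<in> {tm (k - 1)..tm (Suc k)}" "y \<in> {tm (k - 1)..tm (Suc k)}"
    then have "norm (\<psi>2 x) \<le> M" "norm (\<psi>2 y) \<le> M"
      using window[of k] \<psi>2_bound by blast+
    then show "norm (\<psi>2 x - \<psi>2 y) \<le> 2 * M"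
      using norm_triangle_ineq4[of "\<psi>2 x" "\<psi>2 y"] by linarith
  qed (use M_nonneg in auto)
  also have "\<dots> = osc_const * (2 * M * (h * real K)) * h\<^sup>2"
    by (simp add: power2_eq_square power3_eq_cube mult_ac)
  finally show ?thesis by (simp add: hK)
qed

text \<open>
  Every point lies in at most two of the windows, up to endpoints.
\<close>

lemma window_integral_sum:
  fixes \<phi> :: "real \<Rightarrow> real"
  assumes \<phi>: "\<phi> integrable_on {t0..T}" and pos: "\<And>t. t \<in> {t0..T} \<Longrightarrow> 0 \<le> \<phi> t"
  shows "(\<Sum>k<K. integral {tm (k - 1)..tm (Suc k)} \<phi>) \<le> 2 * integral {t0..T} \<phi>"
    "k < K \<Longrightarrow> 0 \<le> integral {tm (k - 1)..tm (Suc k)} \<phi>"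
    "k < K \<Longrightarrow> \<phi> integrable_on {tm (k - 1)..tm (Suc k)}"
proof -
  let ?F = "\<lambda>k. integral {t0..tm k} \<phi>"
  have sub: "\<phi> integrable_on {t0..tm k}" if "k \<le> K" for k
    by (rule integrable_subinterval_real[OF \<phi>]) (use tm_range[OF that] in auto)
  show win: "\<phi> integrable_on {tm (k - 1)..tm (Suc k)}" if "k < K" for k
    by (rule integrable_subinterval_real[OF \<phi> window[OF that]])
  show "0 \<le> integral {tm (k - 1)..tm (Suc k)} \<phi>" if "k < K" for k
    using window[OF that] pos by (intro integral_nonneg win that) auto
  have "integral {tm (k - 1)..tm (Suc k)} \<phi> = ?F (Suc k) - ?F (k - 1)" if "k < K" for k
    using Henstock_Kurzweil_Integration.integral_combine[of t0 "tm (k - 1)" "tm (Suc k)" \<phi>] sub[of "Suc k"] that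
      tm_range[of "k - 1"] tm_mono[of "k - 1" "Suc k"] by simp
  then have "(\<Sum>k<K. integral {tm (k - 1)..tm (Suc k)} \<phi>) = (\<Sum>k<K. ?F (Suc k) - ?F (k - 1))"
    by (intro sum.cong) auto
  also have "\<dots> = ?F K + ?F (K - 1) - (?F 0 + ?F 0)"
    by (rule sum_central_difference)
  finally have "(\<Sum>k<K. integral {tm (k - 1)..tm (Suc k)} \<phi>) = ?F K + ?F (K - 1) - (?F 0 + ?F 0)" .
  moreover have "?F (K - 1) \<le> ?F K"
    using tm_mono[of "K - 1" K] tm_range[of K] by (intro integral_subset_le sub) (auto intro!: pos)
  ultimately show "(\<Sum>k<K. integral {tm (k - 1)..tm (Suc k)} \<phi>) \<le> 2 * integral {t0..T} \<phi>"
    by (simp add: tm_K)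
qed

lemma \<psi>2_increment:
  assumes k: "k < K" and xy: "x \<in> {tm (k - 1)..tm (Suc k)}" "y \<in> {tm (k - 1)..tm (Suc k)}"
    and int: "(\<lambda>t. norm (\<psi>3 t - \<gamma>)) integrable_on {tm (k - 1)..tm (Suc k)}"
  shows "norm (\<psi>2 x - \<psi>2 y - (x - y) *\<^sub>R \<gamma>) \<le> integral {tm (k - 1)..tm (Suc k)} (\<lambda>t. norm (\<psi>3 t - \<gamma>))"
proof (rule increment_minus_linear_le[OF _ int xy])
  fix t assume "t \<in> {tm (k - 1)..tm (Suc k)}"
  then show "(\<psi>2 has_vector_derivative \<psi>3 t) (at t within {tm (k - 1)..tm (Suc k)})"
    using window[OF k] by (intro has_vector_derivative_within_subset[OF \<psi>2_deriv window[OF k]]) auto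
qed

lemma norm_\<psi>3_integrable: "(\<lambda>t. norm (\<psi>3 t)) integrable_on {t0..T}"
  using \<psi>3_integrable by (simp add: absolutely_integrable_on_def)

lemma \<psi>2_variation:
  assumes "k < K" "x \<in> {tm (k - 1)..tm (Suc k)}" "y \<in> {tm (k - 1)..tm (Suc k)}"
  shows "norm (\<psi>2 x - \<psi>2 y) \<le> integral {tm (k - 1)..tm (Suc k)} (\<lambda>t. norm (\<psi>3 t))"
  using \<psi>2_increment[OF assms, of 0] window_integral_sum(3)[OF norm_\<psi>3_integrable _ assms(1)] by simp

lemma error_le_integral: "norm (err K) \<le> 2 * osc_const * integral {t0..T} (\<lambda>t. norm (\<psi>3 t)) * h^3"
proof -
  note w = window_integral_sum[OF norm_\<psi>3_integrable]
  have "norm (err K) \<le> osc_const * h^3 * (\<Sum>k<K. integral {tm (k - 1)..tm (Suc k)} (\<lambda>t. norm (\<psi>3 t)))"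
  proof (rule error_le_sum_oscillation)
    show "0 \<le> integral {tm (k - 1)..tm (Suc k)} (\<lambda>t. norm (\<psi>3 t))" if "k < K" for k
      by (rule w(2)) (use that in auto)
  qed (rule \<psi>2_variation)
  also have "\<dots> \<le> osc_const * h^3 * (2 * integral {t0..T} (\<lambda>t. norm (\<psi>3 t)))"
    using h_pos c_nonneg B_nonneg less
    by (intro mult_left_mono w) (auto simp: osc_const_def)
  finally show ?thesis by (simp add: mult_ac)
qed

section \<open>The leading term of the local errors telescopes\<close>

text \<open>
  What \<open>global_error\<close> yields for the correction and the remainders of \<open>error_sharp\<close>, divided by
  \<open>h\<^sup>3\<close>: \<open>B\<^sup>2 M / 16\<close> is the size of the correction; in the sum of the remainders, \<open>4 + B\<close> bounds
  the parts that tend to zero with \<open>h\<close>, the next two terms belong to the first step, and the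
  multiple of \<open>T - t0\<close> collects the contributions of size \<open>h\<^sup>4\<close>.
\<close>

definition sharp_const :: real where
  "sharp_const = B\<^sup>2 * M / 16 + exp (2 * \<Lambda> * (T - t0)) *
     (B\<^sup>2 * M / 16 + (4 + B + 2 * B * M + B\<^sup>2 * M / 8
        + (2 * B * c * M + B\<^sup>2 * M + (c + B) * M + 4 * c * B * M) * (T - t0))
      + 2 * \<Lambda> * (T - t0) * (B\<^sup>2 * M / 16))"

text \<open>
  Integrating the coefficient of \<open>\<delta>\<close> in \<open>defect_expansion\<close> gives \<open>h\<^sup>3/24 + h\<^sup>3/12 = h\<^sup>3/8\<close>.  Freezing
  \<open>m\<close> at the grid point costs its modulus of continuity \<open>\<nu>\<close> times the crude bound for the defect.
\<close>

lemma averaged_defect_integral: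
  assumes k: "1 \<le> k" "k < K"
    and m: "\<And>\<tau>. \<tau> \<in> {0..h} \<Longrightarrow> norm (m (tm k + \<tau>) - m (tm k)) \<le> \<nu>"
    and \<phi>: "\<And>x y. x \<in> {tm (k - 1)..tm (Suc k)} \<Longrightarrow> y \<in> {tm (k - 1)..tm (Suc k)} \<Longrightarrow>
      norm (\<psi>2 x - \<psi>2 y) \<le> \<phi>"
    and \<eta>: "\<And>x y. x \<in> {tm (k - 1)..tm (Suc k)} \<Longrightarrow> y \<in> {tm (k - 1)..tm (Suc k)} \<Longrightarrow>
      norm (\<psi>2 x - \<psi>2 y - ((x - y) / h) *\<^sub>R \<delta>) \<le> \<eta>"
  shows "norm (integral {0..h} (\<lambda>\<tau>. m (tm k + \<tau>) * defect k \<tau>) - (h^3 / 8) *\<^sub>R (m (tm k) * \<delta>))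
    \<le> h^3 * (\<nu> * \<phi> + B * \<eta>)"
proof -
  have s: "t0 \<le> tm k" "tm k + h \<le> T" using tm_range[of k] tm_range[of "Suc k"] k by (auto simp: tm_Suc)
  let ?p = "\<lambda>\<tau>. \<tau>^3 / (6 * h) + \<tau>\<^sup>2 / 4"
  have "(?p has_integral (h^4 / (24 * h) + h^3 / 12) - (0^4 / (24 * h) + 0^3 / 12)) {0..h}"
    using h_pos by (intro fundamental_theorem_of_calculus)
      (auto intro!: derivative_eq_intros simp: field_simps simp flip: has_real_derivative_iff_has_vector_derivative)
  then have "(?p has_integral h^3 / 8) {0..h}"
    using h_pos by (simp add: power4_eq_xxxx power3_eq_cube mult.assoc)
  from has_integral_linear[OF this bounded_linear_scaleR_left[of "m (tm k) * \<delta>"]]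
  have p: "((\<lambda>\<tau>. ?p \<tau> *\<^sub>R (m (tm k) * \<delta>)) has_integral (h^3 / 8) *\<^sub>R (m (tm k) * \<delta>)) {0..h}"
    by (simp add: o_def)
  have i: "(\<lambda>\<tau>. m (tm k + \<tau>) * defect k \<tau>) integrable_on {0..h}"
    by (intro step_integrable defect_cont k s)
  have "norm (integral {0..h} (\<lambda>\<tau>. m (tm k + \<tau>) * defect k \<tau> - ?p \<tau> *\<^sub>R (m (tm k) * \<delta>)))
      \<le> h * (\<nu> * (\<phi> * h\<^sup>2) + B * (\<eta> * h\<^sup>2))"
  proof (rule integral_norm_le)
    fix \<tau> assume \<tau>: "\<tau> \<in> {0..h}"
    have "m (tm k + \<tau>) * defect k \<tau> - ?p \<tau> *\<^sub>R (m (tm k) * \<delta>)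
        = (m (tm k + \<tau>) - m (tm k)) * defect k \<tau> + m (tm k) * (defect k \<tau> - ?p \<tau> *\<^sub>R \<delta>)"
      by (simp add: left_diff_distrib right_diff_distrib)
    also have "norm \<dots> \<le> \<nu> * (\<phi> * h\<^sup>2) + B * (\<eta> * h\<^sup>2)"
      using s h_pos
      by (intro norm_triangle_le add_mono times_bound m \<tau> m_bound defect_bound[OF k(2) \<tau> \<phi>]
          defect_expansion[OF k \<tau> \<eta>]) auto
    finally show "norm (m (tm k + \<tau>) * defect k \<tau> - ?p \<tau> *\<^sub>R (m (tm k) * \<delta>)) \<le> \<nu> * (\<phi> * h\<^sup>2) + B * (\<eta> * h\<^sup>2)" .
  qed (use h_pos in \<open>auto intro!: integrable_diff i has_integral_integrable[OF p]\<close>)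
  then show ?thesis
    unfolding integral_diff[OF i has_integral_integrable[OF p]] integral_unique[OF p]
    by (simp add: distrib_left power2_eq_square power3_eq_cube mult_ac)
qed

text \<open>
  The cancellation: with \<open>a, b\<close> the values of \<open>m\<close> and \<open>p, q\<close> those of \<open>\<psi>\<close> at the ends of the step,
  \<open>2 a (b q - a p) = (b\<^sup>2 q - a\<^sup>2 p) + a\<^sup>2 (q - p) - (b - a)\<^sup>2 q\<close>.  One factor \<open>b - a\<close> of the last term
  is small, and the other, times \<open>q\<close>, is the increment of \<open>\<psi>''\<close> up to \<open>O(h)\<close>, whose
  sum over all steps stays bounded.
\<close>

lemma telescoping_bracket:
  assumes k: "k < K"
    and m: "norm (m (tm (Suc k)) - m (tm k)) \<le> \<nu>"
    and \<phi>: "norm (\<psi>2 (tm (Suc k)) - \<psi>2 (tm k)) \<le> \<phi>"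
  shows "norm (2 *\<^sub>R (m (tm k) * (\<psi>2 (tm (Suc k)) - \<psi>2 (tm k)))
      - (m (tm (Suc k)) * m (tm (Suc k)) * \<psi> (tm (Suc k)) - m (tm k) * m (tm k) * \<psi> (tm k)))
    \<le> 2 * B * c * M * h + B\<^sup>2 * M * h + \<nu> * (\<phi> + (c + B) * M * h)"
proof -
  define a b p q where "a = m (tm k)" and "b = m (tm (Suc k))" and "p = \<psi> (tm k)" and "q = \<psi> (tm (Suc k))"
  define d where "d = \<psi>2 (tm (Suc k)) - \<psi>2 (tm k)"
  have t: "tm k \<in> {t0..T}" "tm (Suc k) \<in> {t0..T}" using tm_range[of k] tm_range[of "Suc k"] k by auto
  have d: "d = L *v (q - p) + (b * q - a * p)"
    unfolding d_def a_def b_def p_def q_def KG[OF t(1)] KG[OF t(2)]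
    by (simp add: matrix_vector_mult_diff_distrib)
  have "norm (q - p) \<le> M * \<bar>tm (Suc k) - tm k\<bar>"
    unfolding p_def q_def by (rule vector_derivative_norm_bound[OF \<psi>_deriv \<psi>1_bound]) (use t in auto)
  then have qp: "norm (q - p) \<le> M * h" using h_pos by (simp add: tm_Suc)
  have ab: "norm a \<le> B" unfolding a_def by (rule m_bound[OF t(1)])
  have Lqp: "norm (L *v (q - p)) \<le> c * (M * h)"
    by (rule order_trans[OF L_bound mult_left_mono[OF qp c_nonneg]])
  have e: "2 *\<^sub>R (a * d) - (b * b * q - a * a * p)
      = 2 *\<^sub>R (a * (L *v (q - p))) + a * (a * (q - p)) - (b - a) * (d - L *v (q - p) - a * (q - p))"
    unfolding d by (simp add: algebra_simps scaleR_2)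
  have x: "norm (2 *\<^sub>R (a * (L *v (q - p)))) \<le> 2 * (B * (c * (M * h)))"
    using times_bound[OF ab Lqp] by simp
  have y: "norm (a * (a * (q - p))) \<le> B * (B * (M * h))"
    by (intro times_bound ab qp)
  have "norm (d - L *v (q - p) - a * (q - p)) \<le> \<phi> + c * (M * h) + B * (M * h)"
    using Lqp times_bound[OF ab qp] \<phi>[folded d_def]
    by (intro norm_triangle_le_diff add_mono) auto
  then have z: "norm ((b - a) * (d - L *v (q - p) - a * (q - p))) \<le> \<nu> * (\<phi> + c * (M * h) + B * (M * h))"
    using m by (intro times_bound) (auto simp: a_def b_def)
  have "norm (2 *\<^sub>R (a * d) - (b * b * q - a * a * p))
      \<le> 2 * (B * (c * (M * h))) + B * (B * (M * h)) + \<nu> * (\<phi> + c * (M * h) + B * (M * h))"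
    unfolding e by (intro norm_triangle_le_diff norm_triangle_le add_mono x y z)
  then show ?thesis
    by (simp add: a_def b_def p_def q_def d_def algebra_simps power2_eq_square)
qed

text \<open>
  On a window of length \<open>2 h\<close>, \<open>\<psi>''\<close> follows the line through its values at the ends of the step.
  Both \<open>\<psi>''\<close> and this line are compared with the line of slope \<open>g\<close> at the grid point: the first
  comparison costs the integral of \<open>|\<psi>''' - g|\<close> plus the oscillation of \<open>g\<close>, and the second at most
  twice as much, because \<open>|x - y| \<le> 2 h\<close>.
\<close>

lemma \<psi>2_chord:
  fixes g :: "real \<Rightarrow> complex^'x"
  assumes g: "continuous_on {t0..T} g" and k: "1 \<le> k" "k < K"
    and \<sigma>: "\<And>x y. x \<in> {t0..T} \<Longrightarrow> y \<in> {t0..T} \<Longrightarrow> \<bar>x - y\<bar> \<le> h \<Longrightarrow> norm (g x - g y) \<le> \<sigma>"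
    and xy: "x \<in> {tm (k - 1)..tm (Suc k)}" "y \<in> {tm (k - 1)..tm (Suc k)}"
  shows "norm (\<psi>2 x - \<psi>2 y - ((x - y) / h) *\<^sub>R (\<psi>2 (tm (Suc k)) - \<psi>2 (tm k)))
    \<le> 3 * (integral {tm (k - 1)..tm (Suc k)} (\<lambda>t. norm (\<psi>3 t - g t)) + 2 * h * \<sigma>)"
proof -
  let ?W = "{tm (k - 1)..tm (Suc k)}"
  let ?\<gamma> = "g (tm k)"
  define J where "J = integral ?W (\<lambda>t. norm (\<psi>3 t - ?\<gamma>))"
  have W: "?W \<subseteq> {t0..T}" by (rule window[OF k(2)])
  have w: "tm (k - 1) = tm k - h" "tm (Suc k) = tm k + h" using tm_pred[OF k(1)] tm_Suc by auto
  have kW: "tm k \<in> ?W" "tm (Suc k) \<in> ?W" using w h_pos by auto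
  have ai: "\<psi>3 absolutely_integrable_on ?W" 
    using absolutely_integrable_on_subinterval[OF \<psi>3_integrable W] .
  have gW: "g absolutely_integrable_on ?W"
    using absolutely_integrable_continuous_real[OF continuous_on_subset[OF g W]] .
  have i1: "(\<lambda>t. norm (\<psi>3 t - ?\<gamma>)) integrable_on ?W"
    using set_integral_diff(1)[OF ai absolutely_integrable_on_const[of ?W ?\<gamma>]]
    by (simp add: absolutely_integrable_on_def)
  have i2: "(\<lambda>t. norm (\<psi>3 t - g t)) integrable_on ?W"
    using set_integral_diff(1)[OF ai gW] by (simp add: absolutely_integrable_on_def)
  have inc: "norm (\<psi>2 x - \<psi>2 y - (x - y) *\<^sub>R ?\<gamma>) \<le> J" if "x \<in> ?W" "y \<in> ?W" for x y
    unfolding J_def by (rule \<psi>2_increment[OF k(2) that i1])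
  have J0: "0 \<le> J" using inc[OF kW(1) kW(1)] by simp
  have "J \<le> integral ?W (\<lambda>t. norm (\<psi>3 t - g t) + \<sigma>)"
    unfolding J_def
  proof (rule integral_le[OF i1])
    fix t assume t: "t \<in> ?W"
    then have "\<bar>t - tm k\<bar> \<le> h" using w by auto
    then have "norm (g t - ?\<gamma>) \<le> \<sigma>" using t kW W by (intro \<sigma>) auto
    then show "norm (\<psi>3 t - ?\<gamma>) \<le> norm (\<psi>3 t - g t) + \<sigma>"
      using norm_triangle_ineq[of "\<psi>3 t - g t" "g t - ?\<gamma>"] by simp
  qed (intro integrable_add i2 integrable_const_ivl)
  also have "\<dots> = integral ?W (\<lambda>t. norm (\<psi>3 t - g t)) + 2 * h * \<sigma>"
    using w h_pos unfolding integral_add[OF i2 integrable_const_ivl] by simp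
  finally have J: "J \<le> integral ?W (\<lambda>t. norm (\<psi>3 t - g t)) + 2 * h * \<sigma>" .
  define d where "d = \<psi>2 (tm (Suc k)) - \<psi>2 (tm k) - h *\<^sub>R ?\<gamma>"
  have d: "norm d \<le> J" using inc[OF kW(2,1)] by (simp add: d_def tm_Suc)
  have "\<bar>(x - y) / h\<bar> \<le> 2" using xy w h_pos by (auto simp: field_simps abs_le_iff)
  then have d2: "norm (((x - y) / h) *\<^sub>R d) \<le> 2 * J"
    unfolding norm_scaleR using d J0 by (intro mult_mono) auto
  have "\<psi>2 x - \<psi>2 y - ((x - y) / h) *\<^sub>R (\<psi>2 (tm (Suc k)) - \<psi>2 (tm k))
      = (\<psi>2 x - \<psi>2 y - (x - y) *\<^sub>R ?\<gamma>) - ((x - y) / h) *\<^sub>R d"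
    using h_pos by (simp add: d_def scaleR_diff_right)
  also have "norm \<dots> \<le> J + 2 * J"
    by (intro norm_triangle_le_diff add_mono inc xy d2)
  also have "J + 2 * J = 3 * J" by simp
  also have "\<dots> \<le> 3 * (integral ?W (\<lambda>t. norm (\<psi>3 t - g t)) + 2 * h * \<sigma>)"
    by (intro mult_left_mono J) simp
  finally show ?thesis .
qed

text \<open>
  The smallness conditions are chosen so that the remainders of \<open>\<psi>2_chord\<close> add up to at most \<open>1\<close>
  (both contributions are counted with total weight \<open>6\<close>), and those controlled by the modulus of
  continuity of \<open>m\<close> to at most \<open>4\<close>.  The position component of the local error is of size \<open>h\<^sup>4\<close> by
  itself, so the correction \<open>b\<close> acts on the velocity alone.
\<close>

lemma error_sharp:
  fixes g :: "real \<Rightarrow> complex^'x"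
  assumes g: "continuous_on {t0..T} g"
    and \<sigma>: "\<And>x y. x \<in> {t0..T} \<Longrightarrow> y \<in> {t0..T} \<Longrightarrow> \<bar>x - y\<bar> \<le> h \<Longrightarrow> norm (g x - g y) \<le> \<sigma>"
    and \<nu>: "\<And>x y. x \<in> {t0..T} \<Longrightarrow> y \<in> {t0..T} \<Longrightarrow> \<bar>x - y\<bar> \<le> h \<Longrightarrow> norm (m x - m y) \<le> \<nu>"
    and small: "12 * integral {t0..T} (\<lambda>t. norm (\<psi>3 t - g t)) \<le> 1" "12 * (T - t0) * \<sigma> \<le> 1"
      "\<nu> \<le> 1" "\<nu> * integral {t0..T} (\<lambda>t. norm (\<psi>3 t)) \<le> 1"
  shows "norm (err K) \<le> sharp_const * h^3"
proof -
  let ?H = "T - t0"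
  define \<phi> where "\<phi> k = integral {tm (k - 1)..tm (Suc k)} (\<lambda>t. norm (\<psi>3 t))" for k
  define \<eta> where "\<eta> k = 3 * (integral {tm (k - 1)..tm (Suc k)} (\<lambda>t. norm (\<psi>3 t - g t)) + 2 * h * \<sigma>)" for k
  define b :: "nat \<Rightarrow> (complex^'x) \<times> (complex^'x)" where
    "b k = (0, (h^3 / 16) *\<^sub>R (m (tm k) * m (tm k) * \<psi> (tm k)))" for k
  define \<beta> where "\<beta> = h^3 * (B\<^sup>2 * M / 16)"
  define X where "X = (2 * B * c * M + B\<^sup>2 * M + (c + B) * M + 4 * c * B * M) * h"
  define Y where "Y = 2 * B * M + B\<^sup>2 * M / 8"
  define r where "r k = h^3 * (2 * \<nu> * \<phi> k + B * \<eta> k + X + (if k = 0 then Y else 0))" for k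
  note [simp] = c_nonneg B_nonneg M_nonneg
  have h0: "0 \<le> h" using h_pos by simp
  have \<nu>0: "0 \<le> \<nu>" using \<nu>[of t0 t0] less h0 by simp
  have \<sigma>0: "0 \<le> \<sigma>" using \<sigma>[of t0 t0] less h0 by simp
  have i\<phi>: "(\<lambda>t. norm (\<psi>3 t)) integrable_on {t0..T}" by (rule norm_\<psi>3_integrable)
  have i\<eta>: "(\<lambda>t. norm (\<psi>3 t - g t)) integrable_on {t0..T}"
    using set_integral_diff(1)[OF \<psi>3_integrable absolutely_integrable_continuous_real[OF g]]
    by (simp add: absolutely_integrable_on_def)
  note w\<phi> = window_integral_sum[OF i\<phi> norm_ge_zero] and w\<eta> = window_integral_sum[OF i\<eta> norm_ge_zero]
  have \<phi>0: "0 \<le> \<phi> k" if "k < K" for k unfolding \<phi>_def by (rule w\<phi>(2)[OF that])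
  have \<eta>0: "0 \<le> \<eta> k" if "k < K" for k
    using w\<eta>(2)[OF that] \<sigma>0 h0 by (simp add: \<eta>_def)
  have X0: "0 \<le> X" and Y0: "0 \<le> Y" using h0 by (simp_all add: X_def Y_def)
  have mt: "norm (m (tm k)) \<le> B" "norm (\<psi> (tm k)) \<le> M" if "k \<le> K" for k
    using tm_range[OF that] by (auto intro!: m_bound \<psi>_bound)
  have \<beta>: "norm (b k) \<le> \<beta>" if "k \<le> K" for k
  proof -
    have "norm (b k) = (h^3 / 16) * norm (m (tm k) * m (tm k) * \<psi> (tm k))"
      using h0 by (simp add: b_def norm_Pair)
    also have "\<dots> \<le> (h^3 / 16) * (B * B * M)"
      using h0 by (intro mult_left_mono times_bound mt that) auto
    finally show ?thesis by (simp add: \<beta>_def power2_eq_square)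
  qed
  have \<psi>2M: "norm (\<psi>2 x - \<psi>2 y) \<le> 2 * M"
    if "k < K" "x \<in> {tm (k - 1)..tm (Suc k)}" "y \<in> {tm (k - 1)..tm (Suc k)}" for k x y
  proof -
    have "norm (\<psi>2 x) \<le> M" "norm (\<psi>2 y) \<le> M"
      using that window[of k] \<psi>2_bound by blast+
    then show ?thesis using norm_triangle_ineq4[of "\<psi>2 x" "\<psi>2 y"] by linarith
  qed
  have "norm (err K) \<le> \<beta> + exp (2 * \<Lambda> * ?H) * (\<beta> + (\<Sum>k<K. r k) + 2 * \<Lambda> * ?H * \<beta>)"
  proof (rule global_error[where b=b and p="\<lambda>k. 2 * M * h\<^sup>2"])
    fix k assume k: "k < K"
    show "0 \<le> r k"
      unfolding r_def using \<phi>0[OF k] \<eta>0[OF k] X0 Y0 h0 \<nu>0 by simp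
    show d: "norm (defect k \<tau>) \<le> 2 * M * h\<^sup>2" if "\<tau> \<in> {0..h}" for \<tau>
      by (rule defect_bound[OF k that \<psi>2M[OF k]])
    have s: "t0 \<le> tm k" "tm k + h \<le> T" using tm_range[of k] tm_range[of "Suc k"] k by (auto simp: tm_Suc)
    have "norm (local_err k - (b (Suc k) - b k)) \<le> h^3 * (2 * \<nu> * \<phi> k + B * \<eta> k
        + (2 * B * c * M + B\<^sup>2 * M + (c + B) * M) * h + (if k = 0 then Y else 0))"
    proof (cases "k = 0")
      case True
      have "norm (local_err k) \<le> h * (B * (2 * M * h\<^sup>2))"
        unfolding local_err_def norm_Pair norm_zero zero_power2 add_0_left real_sqrt_abs abs_norm_cancel
        using s h0 by (intro integral_norm_le step_integrable defect_cont k times_bound m_bound d) auto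
      then have "norm (local_err k - (b (Suc k) - b k)) \<le> h * (B * (2 * M * h\<^sup>2)) + (\<beta> + \<beta>)"
        using k by (intro norm_triangle_le_diff add_mono \<beta>) auto
      also have "\<dots> = h^3 * Y"
        by (simp add: \<beta>_def Y_def algebra_simps power2_eq_square power3_eq_cube)
      also have "\<dots> \<le> h^3 * (2 * \<nu> * \<phi> k + B * \<eta> k
        + (2 * B * c * M + B\<^sup>2 * M + (c + B) * M) * h + (if k = 0 then Y else 0))"
        using True \<phi>0[OF k] \<eta>0[OF k] \<nu>0 h0 by (intro mult_left_mono) auto
      finally show ?thesis .
    next
      case False
      then have k1: "1 \<le> k" by simp
      let ?\<delta> = "\<psi>2 (tm (Suc k)) - \<psi>2 (tm k)"
      have kW: "tm k \<in> {tm (k - 1)..tm (Suc k)}" "tm (Suc k) \<in> {tm (k - 1)..tm (Suc k)}"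
        using tm_mono[of "k - 1" k] tm_mono[of k "Suc k"] by auto
      define I where "I = integral {0..h} (\<lambda>\<tau>. m (tm k + \<tau>) * defect k \<tau>)"
      have I: "norm (I - (h^3 / 8) *\<^sub>R (m (tm k) * ?\<delta>)) \<le> h^3 * (\<nu> * \<phi> k + B * \<eta> k)"
        unfolding I_def
      proof (rule averaged_defect_integral[OF k1 k])
        show "norm (m (tm k + \<tau>) - m (tm k)) \<le> \<nu>" if "\<tau> \<in> {0..h}" for \<tau>
          using that s by (intro \<nu>) auto
      qed (use \<psi>2_variation[OF k] \<psi>2_chord[OF g k1 k \<sigma>] in \<open>auto simp: \<phi>_def \<eta>_def\<close>)
      define Z where "Z = 2 *\<^sub>R (m (tm k) * ?\<delta>)
        - (m (tm (Suc k)) * m (tm (Suc k)) * \<psi> (tm (Suc k)) - m (tm k) * m (tm k) * \<psi> (tm k))"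
      define Q where "Q = 2 * B * c * M * h + B\<^sup>2 * M * h + \<nu> * (\<phi> k + (c + B) * M * h)"
      have Q0: "0 \<le> Q" using \<phi>0[OF k] \<nu>0 h0 by (simp add: Q_def)
      have "norm Z \<le> Q"
        unfolding Z_def Q_def
        using s h0 \<psi>2_variation[OF k kW(2,1)] by (intro telescoping_bracket k \<nu>) (auto simp: \<phi>_def tm_Suc)
      then have Z: "norm ((h^3 / 16) *\<^sub>R Z) \<le> h^3 * Q"
        unfolding norm_scaleR using h0 Q0 by (intro mult_mono) auto
      have "local_err k - (b (Suc k) - b k) = (0, (I - (h^3 / 8) *\<^sub>R (m (tm k) * ?\<delta>)) + (h^3 / 16) *\<^sub>R Z)"
        by (simp add: local_err_def b_def I_def Z_def algebra_simps)
      then have "norm (local_err k - (b (Suc k) - b k)) = norm ((I - (h^3 / 8) *\<^sub>R (m (tm k) * ?\<delta>)) + (h^3 / 16) *\<^sub>R Z)"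
        by (simp add: norm_Pair)
      also have "\<dots> \<le> h^3 * (\<nu> * \<phi> k + B * \<eta> k) + h^3 * Q"
        by (intro norm_triangle_le add_mono I Z)
      also have "\<dots> = h^3 * (2 * \<nu> * \<phi> k + B * \<eta> k + (2 * B * c * M + B\<^sup>2 * M + \<nu> * ((c + B) * M)) * h)"
        by (simp add: Q_def algebra_simps)
      also have "\<dots> \<le> h^3 * (2 * \<nu> * \<phi> k + B * \<eta> k + (2 * B * c * M + B\<^sup>2 * M + 1 * ((c + B) * M)) * h)"
        using h0 small(3) by (intro mult_left_mono add_left_mono mult_right_mono) auto
      finally show ?thesis using False by simp
    qed
    moreover have "2 * c * B * h\<^sup>2 * (2 * M * h\<^sup>2) = h^3 * (4 * c * B * M * h)"
      by (simp add: power2_eq_square power3_eq_cube)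
    moreover have "r k = h^3 * (2 * \<nu> * \<phi> k + B * \<eta> k
        + (2 * B * c * M + B\<^sup>2 * M + (c + B) * M) * h + (if k = 0 then Y else 0)) + h^3 * (4 * c * B * M * h)"
      by (cases "k = 0") (simp_all add: r_def X_def algebra_simps)
    ultimately show "norm (local_err k - (b (Suc k) - b k)) + 2 * c * B * h\<^sup>2 * (2 * M * h\<^sup>2) \<le> r k"
      by linarith
  qed (rule \<beta>)
  moreover have "(\<Sum>k<K. r k) \<le> h^3 * (4 + B + Y + (2 * B * c * M + B\<^sup>2 * M + (c + B) * M + 4 * c * B * M) * ?H)"
  proof -
    have "\<nu> * (\<Sum>k<K. \<phi> k) \<le> \<nu> * (2 * integral {t0..T} (\<lambda>t. norm (\<psi>3 t)))"
      unfolding \<phi>_def by (intro mult_left_mono w\<phi>(1) \<nu>0)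
    then have 1: "2 * \<nu> * (\<Sum>k<K. \<phi> k) \<le> 4" using small(4) by (simp add: algebra_simps)
    have "(\<Sum>k<K. \<eta> k) = 3 * (\<Sum>k<K. integral {tm (k - 1)..tm (Suc k)} (\<lambda>t. norm (\<psi>3 t - g t))) + 6 * (h * real K) * \<sigma>"
      by (simp add: \<eta>_def sum.distrib algebra_simps flip: sum_distrib_left)
    also have "\<dots> \<le> 1"
      using w\<eta>(1) small(1,2) unfolding hK by (simp add: algebra_simps)
    finally have "B * (\<Sum>k<K. \<eta> k) \<le> B * 1" by (intro mult_left_mono) auto
    moreover have "(\<Sum>k<K. if k = 0 then Y else 0) = Y"
      using K by (simp add: sum.delta)
    moreover have "(\<Sum>k<K. X) = (2 * B * c * M + B\<^sup>2 * M + (c + B) * M + 4 * c * B * M) * ?H"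
      unfolding hK[symmetric] by (simp add: X_def)
    moreover have "(\<Sum>k<K. r k) = h^3 * (2 * \<nu> * (\<Sum>k<K. \<phi> k) + B * (\<Sum>k<K. \<eta> k) + (\<Sum>k<K. X) + (\<Sum>k<K. if k = 0 then Y else 0))"
      by (simp only: r_def sum_distrib_left[symmetric] sum.distrib)
    ultimately show ?thesis using 1 h0 by (auto intro!: mult_left_mono)
  qed
  ultimately have "norm (err K) \<le> \<beta> + exp (2 * \<Lambda> * ?H) * (\<beta>
      + h^3 * (4 + B + Y + (2 * B * c * M + B\<^sup>2 * M + (c + B) * M + 4 * c * B * M) * ?H) + 2 * \<Lambda> * ?H * \<beta>)"
    by (elim order_trans) (auto intro!: mult_left_mono)
  also have "\<dots> = sharp_const * h^3"
    by (simp add: sharp_const_def \<beta>_def Y_def algebra_simps)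
  finally show ?thesis .
qed

end

context kg_problem
begin

text \<open>
  The conditions of \<open>error_sharp\<close> hold for small \<open>h\<close>, by uniform continuity of \<open>g\<close> and \<open>m\<close>; how small
  depends on the solution, but the constant does not.
\<close>

lemma eventually_error_sharp:
  "\<forall>\<^sub>F K in sequentially. norm (kg_grid.err G L m t0 u v \<psi> \<psi>1 ((T - t0) / real K) K)
     \<le> kg_grid.sharp_const t0 T c B M * ((T - t0) / real K) ^ 3"
proof -
  let ?H = "T - t0"
  obtain g where g: "continuous_on {t0..T} g" "integral {t0..T} (\<lambda>t. norm (\<psi>3 t - g t)) < 1 / 12"
    using absolutely_integrable_approx_continuous[OF \<psi>3_integrable, of "1 / 12"] by auto
  define \<sigma> where "\<sigma> = 1 / (12 * ?H)"
  define V where "V = integral {t0..T} (\<lambda>t. norm (\<psi>3 t))"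
  define \<nu> where "\<nu> = 1 / (1 + V)"
  have V: "0 \<le> V" unfolding V_def
    using \<psi>3_integrable by (intro integral_nonneg) (auto simp: absolutely_integrable_on_def)
  have pos: "0 < \<sigma>" "0 < \<nu>" using V less by (auto simp: \<sigma>_def \<nu>_def)
  have modulus: "\<exists>d>0. \<forall>x\<in>{t0..T}. \<forall>y\<in>{t0..T}. \<bar>x - y\<bar> < d \<longrightarrow> norm (f x - f y) \<le> e"
    if "continuous_on {t0..T} f" "0 < e" for f :: "real \<Rightarrow> complex^'x" and e
  proof -
    have "uniformly_continuous_on {t0..T} f"
      using that(1) by (intro compact_uniformly_continuous) auto
    then obtain d where "d > 0" "\<And>x y. x \<in> {t0..T} \<Longrightarrow> y \<in> {t0..T} \<Longrightarrow> dist y x < d \<Longrightarrow> dist (f y) (f x) < e"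
      using \<open>0 < e\<close> unfolding uniformly_continuous_on_def by blast
    then show ?thesis by (intro exI[of _ d]) (force simp: dist_norm less_imp_le)
  qed
  obtain d1 where d1: "d1 > 0" "\<forall>x\<in>{t0..T}. \<forall>y\<in>{t0..T}. \<bar>x - y\<bar> < d1 \<longrightarrow> norm (g x - g y) \<le> \<sigma>"
    using modulus[OF g(1) pos(1)] by blast
  obtain d2 where d2: "d2 > 0" "\<forall>x\<in>{t0..T}. \<forall>y\<in>{t0..T}. \<bar>x - y\<bar> < d2 \<longrightarrow> norm (m x - m y) \<le> \<nu>"
    using modulus[OF m_cont pos(2)] by blast
  have "(\<lambda>K. ?H / real K) \<longlonglongrightarrow> 0" by (rule lim_const_over_n)
  then have "\<forall>\<^sub>F K in sequentially. ?H / real K < min d1 d2"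
    using d1 d2 by (intro order_tendstoD) auto
  then show ?thesis
    using eventually_ge_at_top[of 1]
  proof eventually_elim
    case (elim K)
    interpret kg_grid G L m t0 T u v \<psi> \<psi>1 \<psi>2 \<psi>3 c B M K "?H / real K"
      by unfold_locales (use elim in auto)
    show ?case
    proof (rule error_sharp[OF g(1)])
      show "12 * (T - t0) * \<sigma> \<le> 1" using less by (simp add: \<sigma>_def)
      show "\<nu> \<le> 1" "\<nu> * integral {t0..T} (\<lambda>t. norm (\<psi>3 t)) \<le> 1"
        using V by (simp_all add: \<nu>_def V_def[symmetric])
    qed (use g(2) d1 d2 elim in auto)
  qed
qed

end

section \<open>Convergence of order three\<close>

theorem theorem3p6:
  fixes L G :: "complex^'x^'x" and u v :: "complex^'x" and t0 T A :: real and N :: nat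
  assumes "t0 < T" and "1 \<le> N"
    and "pos_definite (- L)" and "pos_definite G" and "G ** G = - L"
  shows
    "(\<exists>E. E \<longlonglongrightarrow> 0 \<and>
        (\<forall>\<omega> a \<psi> \<psi>1 \<psi>2 \<psi>3.
           nonoscillatory_coeffs t0 T N A a \<longrightarrow>
           negative_mass t0 T (mass N \<omega> a) \<longrightarrow>
           KG_solution L (mass N \<omega> a) t0 T u v \<psi> \<psi>1 \<psi>2 \<psi>3 \<longrightarrow>
           (\<forall>K\<ge>1. Xi3_global_error L G (mass N \<omega> a) t0 T u v \<psi> K \<le> E K))) \<and>
     (\<exists>C. \<forall>\<omega> a \<psi> \<psi>1 \<psi>2 \<psi>3.
           nonoscillatory_coeffs t0 T N A a \<longrightarrow>
           negative_mass t0 T (mass N \<omega> a) \<longrightarrow>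
           KG_solution L (mass N \<omega> a) t0 T u v \<psi> \<psi>1 \<psi>2 \<psi>3 \<longrightarrow>
           (\<forall>K\<ge>1. Xi3_global_error L G (mass N \<omega> a) t0 T u v \<psi> K
              \<le> C * integral {t0..T} (\<lambda>t. norm (\<psi>3 t)) * step_size t0 T K ^ 3) \<and>
           (\<forall>\<^sub>F K in sequentially. Xi3_global_error L G (mass N \<omega> a) t0 T u v \<psi> K
              \<le> C * step_size t0 T K ^ 3))"
proof -
  let ?H = "T - t0"
  obtain c where c: "0 \<le> c"
    "\<And>t x. t \<in> {0..?H} \<Longrightarrow> norm (mat_cos (t *\<^sub>R G) *v x - x) \<le> c * t * norm x"
    "\<And>t x. t \<in> {0..?H} \<Longrightarrow> norm ((matrix_inv G ** mat_sin (t *\<^sub>R G)) *v x) \<le> c * t * norm x"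
    "\<And>t x. t \<in> {0..?H} \<Longrightarrow> norm ((G ** mat_sin (t *\<^sub>R G)) *v x) \<le> c * t * norm x"
    "\<And>x. norm (L *v x) \<le> c * norm x"
    using propagator_bounds[of ?H G L] assms(1) by auto
  \<comment> \<open>All constants are fixed here, before the frequencies, the coefficients and the solution.\<close>
  define B where "B = real CARD('x) * (real N * \<bar>A\<bar>)"
  define R where "R = sqrt (((norm u)\<^sup>2 + (norm v)\<^sup>2) * exp ((1 + c + B) * ?H))"
  define M where "M = (1 + c + B) * R"
  have B: "0 \<le> B" by (simp add: B_def)
  have R: "0 \<le> R" by (simp add: R_def)
  have M: "R \<le> M" "(c + B) * R \<le> M"
    using R B c(1) by (simp_all add: M_def algebra_simps)
  have setting: "kg_problem G L (mass N \<omega> a) t0 T u v \<psi> \<psi>1 \<psi>2 \<psi>3 c B M"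
    if a: "nonoscillatory_coeffs t0 T N A a" and sol: "KG_solution L (mass N \<omega> a) t0 T u v \<psi> \<psi>1 \<psi>2 \<psi>3"
    for \<omega> a \<psi> \<psi>1 \<psi>2 \<psi>3
  proof
    have mB: "norm (mass N \<omega> a t) \<le> B" if "t \<in> {t0..T}" for t
      unfolding B_def by (rule mass_bound[OF a that])
    note bd = KG_solution_bound[OF sol mB c(5) c(1) B, folded R_def]
    fix t assume t: "t \<in> {t0..T}"
    show "norm (mass N \<omega> a t) \<le> B" by (rule mB[OF t])
    show "norm (\<psi> t) \<le> M" "norm (\<psi>1 t) \<le> M" "norm (\<psi>2 t) \<le> M"
      using bd[OF _ t] M by (auto intro: order_trans)
  qed (use assms c B sol pos_definite_matrix_inv[OF assms(4)] mass_continuous[OF a] in auto)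
  define C1 where "C1 = kg_grid.osc_const t0 T c B"
  define C2 where "C2 = kg_grid.sharp_const t0 T c B M"
  have err: "Xi3_global_error L G (mass N \<omega> a) t0 T u v \<psi> K
      \<le> norm (kg_grid.err G L (mass N \<omega> a) t0 u v \<psi> \<psi>1 (?H / real K) K)"
    and uniform: "Xi3_global_error L G (mass N \<omega> a) t0 T u v \<psi> K \<le> C1 * (2 * M * ?H) * (?H / real K)\<^sup>2"
    and third: "Xi3_global_error L G (mass N \<omega> a) t0 T u v \<psi> K
      \<le> 2 * C1 * integral {t0..T} (\<lambda>t. norm (\<psi>3 t)) * (?H / real K) ^ 3"
    if "nonoscillatory_coeffs t0 T N A a" "KG_solution L (mass N \<omega> a) t0 T u v \<psi> \<psi>1 \<psi>2 \<psi>3" "1 \<le> K"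
    for \<omega> a \<psi> \<psi>1 \<psi>2 \<psi>3 K
  proof -
    interpret kg_problem G L "mass N \<omega> a" t0 T u v \<psi> \<psi>1 \<psi>2 \<psi>3 c B M
      by (rule setting[OF that(1,2)])
    interpret kg_grid G L "mass N \<omega> a" t0 T u v \<psi> \<psi>1 \<psi>2 \<psi>3 c B M K "?H / real K"
      by unfold_locales (use that(3) in auto)
    show *: "Xi3_global_error L G (mass N \<omega> a) t0 T u v \<psi> K \<le> norm (err K)"
    proof -
      have "norm (fst (err K)) \<le> norm (err K)"
        using norm_fst_le[of "fst (err K)" "snd (err K)"] by simp
      moreover have "fst (err K) = \<psi> T - fst (Xi3 L G (mass N \<omega> a) t0 (?H / real K) u v K)"
        by (simp add: err_def tm_K)
      ultimately show ?thesis by (simp add: Xi3_global_error_def step_size_def)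
    qed
    from * error_uniform
    show "Xi3_global_error L G (mass N \<omega> a) t0 T u v \<psi> K \<le> C1 * (2 * M * ?H) * (?H / real K)\<^sup>2"
      unfolding C1_def by (rule order_trans)
    from * error_le_integral
    show "Xi3_global_error L G (mass N \<omega> a) t0 T u v \<psi> K
      \<le> 2 * C1 * integral {t0..T} (\<lambda>t. norm (\<psi>3 t)) * (?H / real K) ^ 3"
      unfolding C1_def by (rule order_trans)
  qed
  have sharp: "\<forall>\<^sub>F K in sequentially. Xi3_global_error L G (mass N \<omega> a) t0 T u v \<psi> K \<le> C2 * (?H / real K) ^ 3"
    if "nonoscillatory_coeffs t0 T N A a" "KG_solution L (mass N \<omega> a) t0 T u v \<psi> \<psi>1 \<psi>2 \<psi>3"
    for \<omega> a \<psi> \<psi>1 \<psi>2 \<psi>3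
    using kg_problem.eventually_error_sharp[OF setting[OF that]] eventually_ge_at_top[of 1]
  proof eventually_elim
    case (elim K)
    show ?case unfolding C2_def by (rule order_trans[OF err[OF that elim(2)] elim(1)])
  qed
  define C where "C = max (2 * C1) C2"
  show ?thesis
  proof (intro conjI exI[of _ "\<lambda>K. C1 * (2 * M * ?H) * (?H / real K)\<^sup>2"] exI[of _ C] allI impI)
    have "(\<lambda>K. C1 * (2 * M * ?H) * (?H / real K)\<^sup>2) \<longlonglongrightarrow> C1 * (2 * M * ?H) * 0\<^sup>2"
      by (intro tendsto_intros lim_const_over_n)
    then show "(\<lambda>K. C1 * (2 * M * ?H) * (?H / real K)\<^sup>2) \<longlonglongrightarrow> 0" by simp
  next
    fix \<omega> a \<psi> \<psi>1 \<psi>2 \<psi>3 and K :: nat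
    assume "nonoscillatory_coeffs t0 T N A a" "KG_solution L (mass N \<omega> a) t0 T u v \<psi> \<psi>1 \<psi>2 \<psi>3" "1 \<le> K"
    then show "Xi3_global_error L G (mass N \<omega> a) t0 T u v \<psi> K \<le> C1 * (2 * M * ?H) * (?H / real K)\<^sup>2"
      by (rule uniform)
  next
    fix \<omega> a \<psi> \<psi>1 \<psi>2 \<psi>3 and K :: nat
    assume *: "nonoscillatory_coeffs t0 T N A a" "KG_solution L (mass N \<omega> a) t0 T u v \<psi> \<psi>1 \<psi>2 \<psi>3" "1 \<le> K"
    have "(\<lambda>t. norm (\<psi>3 t)) integrable_on {t0..T}"
      using *(2) by (simp add: KG_solution_def absolutely_integrable_on_def)
    then have "0 \<le> integral {t0..T} (\<lambda>t. norm (\<psi>3 t))" by (rule integral_nonneg) simp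
    then have "2 * C1 * integral {t0..T} (\<lambda>t. norm (\<psi>3 t)) * (?H / real K) ^ 3
        \<le> C * integral {t0..T} (\<lambda>t. norm (\<psi>3 t)) * (?H / real K) ^ 3"
      using assms(1) by (intro mult_right_mono) (auto simp: C_def)
    with third[OF *] show "Xi3_global_error L G (mass N \<omega> a) t0 T u v \<psi> K
        \<le> C * integral {t0..T} (\<lambda>t. norm (\<psi>3 t)) * step_size t0 T K ^ 3"
      by (simp add: step_size_def)
  next
    fix \<omega> a \<psi> \<psi>1 \<psi>2 \<psi>3
    assume *: "nonoscillatory_coeffs t0 T N A a" "KG_solution L (mass N \<omega> a) t0 T u v \<psi> \<psi>1 \<psi>2 \<psi>3"
    have "C2 * (?H / real K) ^ 3 \<le> C * step_size t0 T K ^ 3" for K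
      unfolding step_size_def using assms(1) by (intro mult_right_mono) (auto simp: C_def)
    with sharp[OF *] show "\<forall>\<^sub>F K in sequentially. Xi3_global_error L G (mass N \<omega> a) t0 T u v \<psi> K
        \<le> C * step_size t0 T K ^ 3"
      by (elim eventually_mono) (rule order_trans)
  qed
qed

end
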